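(* Let $X$ be a regular (Hausdorff) space. First, if $X$ is infinite, the following are equivalent: (i) $X$ is countable. (ii) $\mathrm{MC}_p(X)$ is metrizable. (iii) $\mathrm{MC}_p(X)$ is not discretely selective. (iv) $\mathrm{II} \uparrow_{\mathrm{mark}} \mathsf G_1(\Omega_X,\Omega_X)$. (v) $\mathrm{II} \uparrow_{\mathrm{mark}} \mathsf G_1(\Omega_{\mathrm{MC}_p(X),\mathbf 0},\Omega_{\mathrm{MC}_p(X),\mathbf 0})$. (vi) $\mathrm{II} \uparrow_{\mathrm{mark}} \mathsf G_1(\mathscr D_{\mathrm{MC}_p(X)},\Omega_{\mathrm{MC}_p(X),\mathbf 0})$. Also, if $X$ is non-compact, the following are equivalent: (i) $X$ is hemicompact. (ii) $\mathbb K(X)$ is hemicompact. (iii) $\mathrm{MC}_k(X)$ is metrizable. (iv) $\mathrm{MC}_k(X)$ is not discretely selective. (v) $\mathrm{II} \uparrow_{\mathrm{mark}} \mathsf G_1(\mathcal K_X,\mathcal K_X)$. (vi) $\mathrm{II} \uparrow_{\mathrm{mark}} \mathsf G_1(\Omega_{\mathrm{MC}_k(X),\mathbf 0},\Omega_{\mathrm{MC}_k(X),\mathbf 0})$. (vii) $\mathrm{II} \uparrow_{\mathrm{mark}} \mathsf G_1(\mathscr D_{\mathrm{MC}_k(X)},\Omega_{\mathrm{MC}_k(X),\mathbf 0})$.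
   Context: Minimal cusco maps. A cusco map $\Phi$ from $X$ to $\mathbb R$ assigns to each $x\in X$ a non-empty compact convex set $\Phi(x)\subseteq\mathbb R$ and is upper semicontinuous: $\{x\in X:\Phi(x)\subseteq V\}$ is open for every open $V\subseteq\mathbb R$. It is minimal if its graph $\{\langle x,y\rangle:y\in\Phi(x)\}$ is $\subseteq$-minimal among graphs of cusco maps from $X$ to $\mathbb R$. $\mathrm{MC}(X)$ is the set of all minimal cusco maps from $X$ to $\mathbb R$; $\mathbf 0\in \mathrm{MC}(X)$ is the map constantly $\{0\}$. For $A\subseteq X$ and $\varepsilon>0$, $\mathbf W(A,\varepsilon)$ is the set of pairs $\langle\Phi,\Psi\rangle$ such that for all $x\in A$, $\Phi(x)\subseteq\bigcup_{y\in\Psi(x)}B(y,\varepsilon)$ and $\Psi(x)\subseteq\bigcup_{y\in\Phi(x)}B(y,\varepsilon)$, where $B(y,\varepsilon)=(y-\varepsilon,y+\varepsilon)$. For a family $\mathcal A$ of subsets of $X$, $\mathrm{MC}_{\mathcal A}(X)$ is $\mathrm{MC}(X)$ with the topology generated by the uniformity with base $\{\mathbf W(A,\varepsilon):A\in\mathcal A,\varepsilon>0\}$. $\mathrm{MC}_p(X)$ (resp. $\mathrm{MC}_k(X)$) is the case where $\mathcal A$ is the family of non-empty finite (resp. non-empty compact) subsets of $X$. Collections. $\Omega_X$ (resp. $\mathcal K_X$) is the set of all open covers $\mathscr U$ of $X$ with $\emptyset\notin\mathscr U$, $X\notin\mathscr U$ such that every finite (resp. compact) subset of $X$ is contained in some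 $U\in\mathscr U$. For a space $Y$ and $y\in Y$: $\Omega_{Y,y}=\{A\subseteq Y:y\in\mathrm{cl}_Y(A)\}$; $\mathscr D_Y$ is the set of dense subsets of $Y$. A space $Y$ is discretely selective if for every sequence $\langle U_n:n\in\omega\rangle$ of non-empty open subsets of $Y$ there are $y_n\in U_n$ such that $\{y_n:n\in\omega\}$ is closed and discrete in $Y$. $Y$ is hemicompact if there is a sequence of compact subsets of $Y$ such that every compact subset of $Y$ is contained in one of them. $\mathbb K(X)$ is the set of non-empty compact subsets of $X$ with the Vietoris topology. Games. In $\mathsf G_1(\mathcal C,\mathcal D)$, in inning $n\in\omega$ One plays $A_n\in\mathcal C$ and Two responds with $x_n\in A_n$; Two wins if $\{x_n:n\in\omega\}\in\mathcal D$, otherwise One wins. $\mathrm{II}\uparrow_{\mathrm{mark}}\mathcal G$: Two has a winning Markov strategy, i.e. one depending only on One's current move and the inning number $n$. *)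

theory Defs
  imports "HOL-Analysis.Analysis"
begin

text \<open>Set-valued maps on a space \<open>X\<close> are extensional (equal to \<open>undefined\<close> off
  \<open>topspace X\<close>), so that equality of maps is equality of their restrictions to the space.\<close>

definition cusco :: "'a topology \<Rightarrow> ('a \<Rightarrow> real set) set" where
  "cusco X = {\<Phi> \<in> topspace X \<rightarrow>\<^sub>E {K. K \<noteq> {} \<and> compact K \<and> convex K}.
                 \<forall>V. open V \<longrightarrow> openin X {x \<in> topspace X. \<Phi> x \<subseteq> V}}"

definition cusco_graph :: "'a topology \<Rightarrow> ('a \<Rightarrow> real set) \<Rightarrow> ('a \<times> real) set" where
  "cusco_graph X \<Phi> = (SIGMA x:topspace X. \<Phi> x)"

definition MC :: "'a topology \<Rightarrow> ('a \<Rightarrow> real set) set" where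
  "MC X = {\<Phi> \<in> cusco X.
             \<forall>\<Psi> \<in> cusco X. cusco_graph X \<Psi> \<subseteq> cusco_graph X \<Phi> \<longrightarrow> cusco_graph X \<Psi> = cusco_graph X \<Phi>}"

definition MC_zero :: "'a topology \<Rightarrow> 'a \<Rightarrow> real set" where
  "MC_zero X = (\<lambda>x\<in>topspace X. {0})"

definition MC_entourage ::
    "'a topology \<Rightarrow> 'a set \<Rightarrow> real \<Rightarrow> (('a \<Rightarrow> real set) \<times> ('a \<Rightarrow> real set)) set" where
  "MC_entourage X A \<epsilon> =
     {(\<Phi>, \<Psi>) \<in> MC X \<times> MC X.
        \<forall>x\<in>A. \<Phi> x \<subseteq> (\<Union>y\<in>\<Psi> x. ball y \<epsilon>) \<and> \<Psi> x \<subseteq> (\<Union>y\<in>\<Phi> x. ball y \<epsilon>)}"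

text \<open>A set is open in the uniform topology iff it contains, around each of its points, the
  section of some basic entourage. This is a topology when the family of sets is directed
  under inclusion, as shown below; this covers the finite and the compact sets.\<close>

definition MC_topology :: "'a topology \<Rightarrow> 'a set set \<Rightarrow> ('a \<Rightarrow> real set) topology" where
  "MC_topology X \<A> =
     topology (\<lambda>U. U \<subseteq> MC X \<and> (\<forall>\<Phi>\<in>U. \<exists>A\<in>\<A>. \<exists>\<epsilon>>0. MC_entourage X A \<epsilon> `` {\<Phi>} \<subseteq> U))"

definition MC_p :: "'a topology \<Rightarrow> ('a \<Rightarrow> real set) topology" where
  "MC_p X = MC_topology X {F. F \<noteq> {} \<and> finite F \<and> F \<subseteq> topspace X}"

definition MC_k :: "'a topology \<Rightarrow> ('a \<Rightarrow> real set) topology" where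
  "MC_k X = MC_topology X {K. K \<noteq> {} \<and> compactin X K}"

lemma MC_entourage_mono:
  assumes "A \<subseteq> B" "\<delta> \<le> \<epsilon>"
  shows "MC_entourage X B \<delta> \<subseteq> MC_entourage X A \<epsilon>"
proof -
  have "ball y \<delta> \<subseteq> ball y \<epsilon>" for y :: real
    using assms(2) by auto
  then show ?thesis
    using assms(1) unfolding MC_entourage_def by blast
qed

lemma openin_MC_topology:
  assumes dir: "\<And>A B. A \<in> \<A> \<Longrightarrow> B \<in> \<A> \<Longrightarrow> \<exists>C\<in>\<A>. A \<union> B \<subseteq> C"
  shows "openin (MC_topology X \<A>) U \<longleftrightarrow>
           U \<subseteq> MC X \<and> (\<forall>\<Phi>\<in>U. \<exists>A\<in>\<A>. \<exists>\<epsilon>>0. MC_entourage X A \<epsilon> `` {\<Phi>} \<subseteq> U)"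
proof -
  let ?P = "\<lambda>U \<Phi>. \<exists>A\<in>\<A>. \<exists>\<epsilon>>0. MC_entourage X A \<epsilon> `` {\<Phi>} \<subseteq> U"
  have int: "?P (S \<inter> T) \<Phi>" if S: "?P S \<Phi>" and T: "?P T \<Phi>" for S T \<Phi>
  proof -
    obtain A \<delta> where A: "A \<in> \<A>" "\<delta> > 0" "MC_entourage X A \<delta> `` {\<Phi>} \<subseteq> S"
      using S by blast
    obtain B \<epsilon> where B: "B \<in> \<A>" "\<epsilon> > 0" "MC_entourage X B \<epsilon> `` {\<Phi>} \<subseteq> T"
      using T by blast
    obtain C where C: "C \<in> \<A>" "A \<subseteq> C" "B \<subseteq> C"
      using dir[OF A(1) B(1)] by blast
    have "MC_entourage X C (min \<delta> \<epsilon>) \<subseteq> MC_entourage X A \<delta>"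
         "MC_entourage X C (min \<delta> \<epsilon>) \<subseteq> MC_entourage X B \<epsilon>"
      using C by (simp_all add: MC_entourage_mono)
    then have "MC_entourage X C (min \<delta> \<epsilon>) `` {\<Phi>} \<subseteq> S \<inter> T"
      using A(3) B(3) by blast
    moreover have "min \<delta> \<epsilon> > 0"
      using A B by simp
    ultimately show ?thesis
      using C(1) by blast
  qed
  have mono: "?P T \<Phi>" if "?P S \<Phi>" "S \<subseteq> T" for S T \<Phi>
    using that by (meson order_trans)
  have "istopology (\<lambda>U. U \<subseteq> MC X \<and> (\<forall>\<Phi>\<in>U. ?P U \<Phi>))"
    unfolding istopology_def
  proof (intro conjI allI impI)
    fix S T assume *: "S \<subseteq> MC X \<and> (\<forall>\<Phi>\<in>S. ?P S \<Phi>)" "T \<subseteq> MC X \<and> (\<forall>\<Phi>\<in>T. ?P T \<Phi>)"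
    show "S \<inter> T \<subseteq> MC X" using * by blast
    show "\<forall>\<Phi>\<in>S \<inter> T. ?P (S \<inter> T) \<Phi>" using * int by (metis IntD1 IntD2)
  next
    fix \<K> assume *: "\<forall>K\<in>\<K>. K \<subseteq> MC X \<and> (\<forall>\<Phi>\<in>K. ?P K \<Phi>)"
    show "\<Union>\<K> \<subseteq> MC X" using * by blast
    show "\<forall>\<Phi>\<in>\<Union>\<K>. ?P (\<Union>\<K>) \<Phi>" using * mono by (metis UnionE Union_upper)
  qed
  then show ?thesis
    unfolding MC_topology_def by (simp add: topology_inverse')
qed

lemma topspace_MC_topology:
  assumes "\<And>A B. A \<in> \<A> \<Longrightarrow> B \<in> \<A> \<Longrightarrow> \<exists>C\<in>\<A>. A \<union> B \<subseteq> C" "\<A> \<noteq> {}"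
  shows "topspace (MC_topology X \<A>) = MC X"
proof
  show "topspace (MC_topology X \<A>) \<subseteq> MC X"
    using openin_MC_topology[OF assms(1)] openin_topspace by metis
  obtain A where "A \<in> \<A>"
    using assms(2) by blast
  moreover have "MC_entourage X A 1 `` {\<Phi>} \<subseteq> MC X" for \<Phi>
    by (auto simp: MC_entourage_def)
  ultimately have "openin (MC_topology X \<A>) (MC X)"
    using openin_MC_topology[OF assms(1), where X = X and U = "MC X"] zero_less_one by blast
  then show "MC X \<subseteq> topspace (MC_topology X \<A>)"
    by (rule openin_subset)
qed

lemma openin_MC_p:
  "openin (MC_p X) U \<longleftrightarrow> U \<subseteq> MC X \<and>
     (\<forall>\<Phi>\<in>U. \<exists>F\<in>{F. F \<noteq> {} \<and> finite F \<and> F \<subseteq> topspace X}. \<exists>\<epsilon>>0. MC_entourage X F \<epsilon> `` {\<Phi>} \<subseteq> U)"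
  unfolding MC_p_def
proof (rule openin_MC_topology)
  fix A B assume "A \<in> {F. F \<noteq> {} \<and> finite F \<and> F \<subseteq> topspace X}"
    "B \<in> {F. F \<noteq> {} \<and> finite F \<and> F \<subseteq> topspace X}"
  then show "\<exists>C\<in>{F. F \<noteq> {} \<and> finite F \<and> F \<subseteq> topspace X}. A \<union> B \<subseteq> C"
    by (intro bexI[of _ "A \<union> B"]) auto
qed

lemma openin_MC_k:
  "openin (MC_k X) U \<longleftrightarrow> U \<subseteq> MC X \<and>
     (\<forall>\<Phi>\<in>U. \<exists>K\<in>{K. K \<noteq> {} \<and> compactin X K}. \<exists>\<epsilon>>0. MC_entourage X K \<epsilon> `` {\<Phi>} \<subseteq> U)"
  unfolding MC_k_def
proof (rule openin_MC_topology)
  fix A B assume "A \<in> {K. K \<noteq> {} \<and> compactin X K}" "B \<in> {K. K \<noteq> {} \<and> compactin X K}"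
  then show "\<exists>C\<in>{K. K \<noteq> {} \<and> compactin X K}. A \<union> B \<subseteq> C"
    by (intro bexI[of _ "A \<union> B"]) (auto intro: compactin_Un)
qed

lemma topspace_MC_p:
  assumes "topspace X \<noteq> {}"
  shows "topspace (MC_p X) = MC X"
  unfolding MC_p_def
proof (rule topspace_MC_topology)
  fix A B assume "A \<in> {F. F \<noteq> {} \<and> finite F \<and> F \<subseteq> topspace X}"
    "B \<in> {F. F \<noteq> {} \<and> finite F \<and> F \<subseteq> topspace X}"
  then show "\<exists>C\<in>{F. F \<noteq> {} \<and> finite F \<and> F \<subseteq> topspace X}. A \<union> B \<subseteq> C"
    by (intro bexI[of _ "A \<union> B"]) auto
next
  obtain x where "x \<in> topspace X" using assms by blast
  then have "{x} \<in> {F. F \<noteq> {} \<and> finite F \<and> F \<subseteq> topspace X}" by simp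
  then show "{F. F \<noteq> {} \<and> finite F \<and> F \<subseteq> topspace X} \<noteq> {}" by blast
qed

lemma topspace_MC_k:
  assumes "topspace X \<noteq> {}"
  shows "topspace (MC_k X) = MC X"
  unfolding MC_k_def
proof (rule topspace_MC_topology)
  fix A B assume "A \<in> {K. K \<noteq> {} \<and> compactin X K}" "B \<in> {K. K \<noteq> {} \<and> compactin X K}"
  then show "\<exists>C\<in>{K. K \<noteq> {} \<and> compactin X K}. A \<union> B \<subseteq> C"
    by (intro bexI[of _ "A \<union> B"]) (auto intro: compactin_Un)
next
  obtain x where "x \<in> topspace X" using assms by blast
  then have "{x} \<in> {K. K \<noteq> {} \<and> compactin X K}" by simp
  then show "{K. K \<noteq> {} \<and> compactin X K} \<noteq> {}" by blast
qed

lemma MC_zero_in_MC: "MC_zero X \<in> MC X"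
proof -
  have "openin X {x \<in> topspace X. MC_zero X x \<subseteq> V}" for V
  proof -
    have "{x \<in> topspace X. MC_zero X x \<subseteq> V} = (if 0 \<in> V then topspace X else {})"
      by (auto simp: MC_zero_def)
    then show ?thesis by simp
  qed
  moreover have "MC_zero X \<in> topspace X \<rightarrow>\<^sub>E {K. K \<noteq> {} \<and> compact K \<and> convex K}"
    by (auto simp: MC_zero_def)
  ultimately have "MC_zero X \<in> cusco X"
    by (simp add: cusco_def)
  moreover have "cusco_graph X \<Psi> = cusco_graph X (MC_zero X)"
    if \<Psi>: "\<Psi> \<in> cusco X" "cusco_graph X \<Psi> \<subseteq> cusco_graph X (MC_zero X)" for \<Psi>
  proof -
    have "\<Psi> x = {0}" if x: "x \<in> topspace X" for x
    proof -
      have "\<Psi> x \<noteq> {}" using \<Psi>(1) x by (auto simp: cusco_def PiE_iff)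
      moreover have "\<Psi> x \<subseteq> {0}"
        using \<Psi>(2) x by (auto simp: cusco_graph_def MC_zero_def)
      ultimately show ?thesis by blast
    qed
    then show ?thesis
      unfolding cusco_graph_def MC_zero_def by (intro Sigma_cong) auto
  qed
  ultimately show ?thesis by (simp add: MC_def)
qed

definition hemicompact_space :: "'a topology \<Rightarrow> bool" where
  "hemicompact_space Y \<longleftrightarrow>
     (\<exists>K :: nat \<Rightarrow> 'a set. (\<forall>n. compactin Y (K n)) \<and> (\<forall>C. compactin Y C \<longrightarrow> (\<exists>n. C \<subseteq> K n)))"

definition discretely_selective :: "'a topology \<Rightarrow> bool" where
  "discretely_selective Y \<longleftrightarrow>
     (\<forall>U :: nat \<Rightarrow> 'a set. (\<forall>n. openin Y (U n) \<and> U n \<noteq> {}) \<longrightarrow>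
        (\<exists>y. (\<forall>n. y n \<in> U n) \<and> closedin Y (range y) \<and>
             subtopology Y (range y) = discrete_topology (range y)))"

definition compact_hyperspace :: "'a topology \<Rightarrow> 'a set set" where
  "compact_hyperspace X = {K. K \<noteq> {} \<and> compactin X K}"

definition vietoris :: "'a topology \<Rightarrow> 'a set topology" where
  "vietoris X = topology_generated_by
     ({{K \<in> compact_hyperspace X. K \<subseteq> U} | U. openin X U} \<union>
      {{K \<in> compact_hyperspace X. K \<inter> U \<noteq> {}} | U. openin X U})"

lemma topspace_vietoris: "topspace (vietoris X) = compact_hyperspace X"
proof
  show "topspace (vietoris X) \<subseteq> compact_hyperspace X"
    unfolding vietoris_def topology_generated_by_topspace by blast
  have "compact_hyperspace X = {K \<in> compact_hyperspace X. K \<subseteq> topspace X}"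
    by (auto simp: compact_hyperspace_def dest: compactin_subset_topspace)
  then show "compact_hyperspace X \<subseteq> topspace (vietoris X)"
    unfolding vietoris_def topology_generated_by_topspace using openin_topspace by blast
qed

definition omega_covers :: "'a topology \<Rightarrow> 'a set set set" where
  "omega_covers X =
     {\<U>. (\<forall>U\<in>\<U>. openin X U) \<and> \<Union>\<U> = topspace X \<and> {} \<notin> \<U> \<and> topspace X \<notin> \<U> \<and>
          (\<forall>F. finite F \<and> F \<subseteq> topspace X \<longrightarrow> (\<exists>U\<in>\<U>. F \<subseteq> U))}"

definition k_covers :: "'a topology \<Rightarrow> 'a set set set" where
  "k_covers X =
     {\<U>. (\<forall>U\<in>\<U>. openin X U) \<and> \<Union>\<U> = topspace X \<and> {} \<notin> \<U> \<and> topspace X \<notin> \<U> \<and>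
          (\<forall>K. compactin X K \<longrightarrow> (\<exists>U\<in>\<U>. K \<subseteq> U))}"

definition clustering_sets :: "'a topology \<Rightarrow> 'a \<Rightarrow> 'a set set" where
  "clustering_sets Y y = {A. A \<subseteq> topspace Y \<and> y \<in> Y closure_of A}"

definition dense_sets :: "'a topology \<Rightarrow> 'a set set" where
  "dense_sets Y = {D. D \<subseteq> topspace Y \<and> Y closure_of D = topspace Y}"

definition winning_markov_G1 ::
    "'a set set \<Rightarrow> 'a set set \<Rightarrow> ('a set \<Rightarrow> nat \<Rightarrow> 'a) \<Rightarrow> bool" where
  "winning_markov_G1 \<C> \<D> \<sigma> \<longleftrightarrow>
     (\<forall>A :: nat \<Rightarrow> 'a set. (\<forall>n. A n \<in> \<C>) \<longrightarrow>
        (\<forall>n. \<sigma> (A n) n \<in> A n) \<and> {\<sigma> (A n) n | n. True} \<in> \<D>)"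

definition II_mark_G1 :: "'a set set \<Rightarrow> 'a set set \<Rightarrow> bool" where
  "II_mark_G1 \<C> \<D> \<longleftrightarrow> (\<exists>\<sigma>. winning_markov_G1 \<C> \<D> \<sigma>)"

end

theory Submission
  imports Defs
begin

text \<open>Both halves of the theorem are instances of one statement about a family \<open>\<A>\<close> of non-empty compact
  sets that contains the singletons and is closed under binary unions: apart from the one about the
  hyperspace, each of the properties listed holds iff \<open>\<A>\<close> has countable cofinality, that is, iff
  some sequence in \<open>\<A>\<close> is cofinal with respect to inclusion (\<open>countable_cofinality_characterizations\<close>).
  For the finite sets this means that \<open>X\<close> is countable, for the compact sets that \<open>X\<close> is hemicompact.

  A cofinal sequence \<open>A n\<close>, which may be taken increasing, gives a countable base of the uniformity,
  hence a metric, and it tells Two what to do in inning \<open>n\<close>: absorb \<open>A n\<close>, or come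
  \<open>1/(n+1)\<close>-close to the zero map on \<open>A n\<close>. A metrizable space with a non-isolated point is not
  discretely selective.

  For the converse implications, countably many open sets of maps, or the answers that a
  Markov strategy of Two allows, restrict attention to countably many members \<open>A n\<close> of \<open>\<A>\<close>. Without countable
  cofinality some \<open>B \<in> \<A>\<close> is contained in none of them, and the points \<open>x n \<in> B - A n\<close> are free. In
  the cover game Two may then be made to answer with the complement of \<open>{x n}\<close>, so that \<open>B\<close> is never
  absorbed. In function spaces one needs maps that are as given on \<open>A n\<close> and have a prescribed value at
  \<open>x n\<close>; they exist by \<open>MC_change_off_closed\<close>, the essential construction. The values \<open>n\<close> yield a closed
  discrete selection, because cusco maps are bounded on the compact set \<open>B\<close>; the value \<open>1\<close> yields a
  sequence of answers that does not cluster at the zero map.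

  The hyperspace is hemicompact iff \<open>X\<close> is, because the union of a compact set of compact sets is
  compact and the compact subsets of a compact set form a compact set.\<close>

section \<open>Hausdorff distance of compact intervals\<close>

text \<open>On compact intervals this is the Hausdorff distance; on arbitrary sets it is still symmetric
  and satisfies the triangle inequality, so these laws carry no side conditions.\<close>

definition endpoint_dist :: "real set \<Rightarrow> real set \<Rightarrow> real" where
  "endpoint_dist K L = max \<bar>Inf K - Inf L\<bar> \<bar>Sup K - Sup L\<bar>"

lemma endpoint_dist_nonneg: "0 \<le> endpoint_dist K L"
  by (simp add: endpoint_dist_def)

lemma endpoint_dist_self [simp]: "endpoint_dist K K = 0"
  by (simp add: endpoint_dist_def)

lemma endpoint_dist_commute: "endpoint_dist K L = endpoint_dist L K"
  by (simp add: endpoint_dist_def abs_minus_commute)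

lemma endpoint_dist_triangle: "endpoint_dist K M \<le> endpoint_dist K L + endpoint_dist L M"
proof -
  have "\<bar>Inf K - Inf M\<bar> \<le> \<bar>Inf K - Inf L\<bar> + \<bar>Inf L - Inf M\<bar>"
    "\<bar>Sup K - Sup M\<bar> \<le> \<bar>Sup K - Sup L\<bar> + \<bar>Sup L - Sup M\<bar>" by linarith+
  then show ?thesis by (simp add: endpoint_dist_def max_def)
qed

lemma compact_interval_eq_endpoints:
  fixes K :: "real set"
  assumes "K \<noteq> {}" "compact K" "convex K"
  shows "K = {Inf K..Sup K}" "Inf K \<le> Sup K"
proof -
  obtain a b where K: "K = {a..b}"
    using assms connected_compact_interval_1 convex_connected by blast
  moreover have "a \<le> b" using assms(1) K by auto
  ultimately show "K = {Inf K..Sup K}" "Inf K \<le> Sup K" by simp_all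
qed

lemma endpoint_dist_eq_0_imp_eq:
  assumes "K \<noteq> {}" "compact K" "convex K" "L \<noteq> {}" "compact L" "convex L"
    and "endpoint_dist K L = 0"
  shows "K = L"
proof -
  have "Inf K = Inf L" "Sup K = Sup L"
    using assms(7) by (auto simp: endpoint_dist_def max_def split: if_splits)
  then show ?thesis
    using compact_interval_eq_endpoints(1)[of K] compact_interval_eq_endpoints(1)[of L] assms by metis
qed

lemma endpoint_dist_less_iff:
  assumes "K \<noteq> {}" "compact K" "convex K" "L \<noteq> {}" "compact L" "convex L"
  shows "K \<subseteq> (\<Union>y\<in>L. ball y \<epsilon>) \<and> L \<subseteq> (\<Union>y\<in>K. ball y \<epsilon>) \<longleftrightarrow> endpoint_dist K L < \<epsilon>"
proof -
  define a b c d where abcd: "a = Inf K" "b = Sup K" "c = Inf L" "d = Sup L"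
  have K: "K = {a..b}" "a \<le> b" and L: "L = {c..d}" "c \<le> d"
    using compact_interval_eq_endpoints[of K] compact_interval_eq_endpoints[of L] assms
    unfolding abcd by auto
  have cover: "{p..q} \<subseteq> (\<Union>y\<in>{r..s}. ball y \<epsilon>) \<longleftrightarrow> r - p < \<epsilon> \<and> q - s < \<epsilon> \<and> 0 < \<epsilon>"
    if "p \<le> q" "r \<le> s" for p q r s :: real
  proof
    assume sub: "{p..q} \<subseteq> (\<Union>y\<in>{r..s}. ball y \<epsilon>)"
    have "p \<in> {p..q}" "q \<in> {p..q}" using that by auto
    then obtain y z where "y \<in> {r..s}" "p \<in> ball y \<epsilon>" "z \<in> {r..s}" "q \<in> ball z \<epsilon>"
      using sub by blast
    then show "r - p < \<epsilon> \<and> q - s < \<epsilon> \<and> 0 < \<epsilon>" by (auto simp: dist_real_def)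
  next
    assume eps: "r - p < \<epsilon> \<and> q - s < \<epsilon> \<and> 0 < \<epsilon>"
    show "{p..q} \<subseteq> (\<Union>y\<in>{r..s}. ball y \<epsilon>)"
    proof
      fix z assume z: "z \<in> {p..q}"
      \<comment> \<open>the point of the second interval nearest to \<open>z\<close>\<close>
      have "max r (min s z) \<in> {r..s}" "z \<in> ball (max r (min s z)) \<epsilon>"
        using z eps that by (auto simp: dist_real_def max_def min_def)
      then show "z \<in> (\<Union>y\<in>{r..s}. ball y \<epsilon>)" by blast
    qed
  qed
  show ?thesis
    unfolding endpoint_dist_def abcd[symmetric] unfolding K(1) L(1) cover[OF K(2) L(2)] cover[OF L(2) K(2)]
    by auto
qed

section \<open>Cusco maps and minimal cusco maps\<close>

lemma cusco_values:
  assumes "\<Phi> \<in> cusco X" "x \<in> topspace X"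
  shows "\<Phi> x \<noteq> {}" "compact (\<Phi> x)" "convex (\<Phi> x)"
  using assms by (auto simp: cusco_def PiE_iff)

lemma openin_cusco:
  assumes "\<Phi> \<in> cusco X" "open V"
  shows "openin X {x \<in> topspace X. \<Phi> x \<subseteq> V}"
  using assms by (auto simp: cusco_def)

lemma cusco_eqI:
  assumes "\<Phi> \<in> cusco X" "\<Psi> \<in> cusco X" "\<And>x. x \<in> topspace X \<Longrightarrow> \<Phi> x = \<Psi> x"
  shows "\<Phi> = \<Psi>"
  using assms by (auto simp: cusco_def PiE_iff intro: extensionalityI)

text \<open>Upper semicontinuity is local, which is the convenient form for maps glued from pieces.\<close>

lemma cuscoI:
  assumes "\<Phi> \<in> extensional (topspace X)"
    and "\<And>x. x \<in> topspace X \<Longrightarrow> \<Phi> x \<noteq> {} \<and> compact (\<Phi> x) \<and> convex (\<Phi> x)"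
    and "\<And>x V. \<lbrakk>x \<in> topspace X; open V; \<Phi> x \<subseteq> V\<rbrakk> \<Longrightarrow> \<exists>N. openin X N \<and> x \<in> N \<and> (\<forall>z\<in>N. \<Phi> z \<subseteq> V)"
  shows "\<Phi> \<in> cusco X"
proof -
  have "openin X {x \<in> topspace X. \<Phi> x \<subseteq> V}" if V: "open V" for V
  proof (rule openin_subopen[THEN iffD2], intro ballI)
    fix x assume "x \<in> {x \<in> topspace X. \<Phi> x \<subseteq> V}"
    then have "\<exists>N. openin X N \<and> x \<in> N \<and> (\<forall>z\<in>N. \<Phi> z \<subseteq> V)"
      using assms(3)[OF _ V, of x] by simp
    then obtain N where N: "openin X N" "x \<in> N" "\<forall>z\<in>N. \<Phi> z \<subseteq> V"
      by blast
    then have "N \<subseteq> {x \<in> topspace X. \<Phi> x \<subseteq> V}"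
      using openin_subset[OF N(1)] by auto
    then show "\<exists>T. openin X T \<and> x \<in> T \<and> T \<subseteq> {x \<in> topspace X. \<Phi> x \<subseteq> V}"
      using N by blast
  qed
  then show ?thesis
    using assms(1,2) by (auto simp: cusco_def PiE_iff)
qed

lemma MC_iff:
  "\<Phi> \<in> MC X \<longleftrightarrow> \<Phi> \<in> cusco X \<and>
     (\<forall>\<Psi>\<in>cusco X. (\<forall>x\<in>topspace X. \<Psi> x \<subseteq> \<Phi> x) \<longrightarrow> (\<forall>x\<in>topspace X. \<Psi> x = \<Phi> x))"
proof -
  have sub: "cusco_graph X \<Psi> \<subseteq> cusco_graph X \<Theta> \<longleftrightarrow> (\<forall>x\<in>topspace X. \<Psi> x \<subseteq> \<Theta> x)" for \<Psi> \<Theta>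
    by (auto simp: cusco_graph_def)
  have eq: "cusco_graph X \<Psi> = cusco_graph X \<Theta> \<longleftrightarrow> (\<forall>x\<in>topspace X. \<Psi> x = \<Theta> x)" for \<Psi> \<Theta>
    unfolding set_eq_subset sub by blast
  show ?thesis
    by (simp add: MC_def sub eq)
qed

lemma MC_imp_cusco: "\<Phi> \<in> MC X \<Longrightarrow> \<Phi> \<in> cusco X"
  by (simp add: MC_def)

lemma constant_in_MC: "(\<lambda>x\<in>topspace X. {c}) \<in> MC X"
proof -
  have cu: "(\<lambda>x\<in>topspace X. {c}) \<in> cusco X"
    by (rule cuscoI) auto
  have "\<Psi> x = {c}"
    if \<Psi>: "\<Psi> \<in> cusco X" "\<forall>x\<in>topspace X. \<Psi> x \<subseteq> {c}" and x: "x \<in> topspace X" for \<Psi> x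
  proof -
    have "\<Psi> x \<subseteq> {c}" using \<Psi>(2) x by blast
    moreover have "\<Psi> x \<noteq> {}" using cusco_values(1)[OF \<Psi>(1) x] .
    ultimately show ?thesis by blast
  qed
  with cu show ?thesis by (simp add: MC_iff)
qed

text \<open>The pointwise intersection of a chain of cusco maps is again cusco: by compactness it has
  non-empty values, and a value contained in an open set \<open>V\<close> forces the value of some member of the
  chain into \<open>V\<close>. Hence Zorn's lemma yields minimal maps.\<close>

lemma minimal_cusco_below:
  assumes \<Phi>: "\<Phi> \<in> cusco X"
  obtains \<Psi> where "\<Psi> \<in> MC X" "\<And>x. x \<in> topspace X \<Longrightarrow> \<Psi> x \<subseteq> \<Phi> x"
proof -
  define S where "S = {\<Psi> \<in> cusco X. \<forall>x\<in>topspace X. \<Psi> x \<subseteq> \<Phi> x}"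
  define P where "P = (\<lambda>\<Psi> \<Theta> :: 'a \<Rightarrow> real set. \<forall>x\<in>topspace X. \<Theta> x \<subseteq> \<Psi> x)"
  have "\<exists>m\<in>S. \<forall>a\<in>S. P m a \<longrightarrow> a = m"
  proof (rule predicate_Zorn)
    show "partial_order_on S (relation_of P S)"
    proof (rule partial_order_on_relation_ofI)
      fix a b assume "a \<in> S" "b \<in> S" "P a b" "P b a"
      then show "a = b"
        unfolding S_def P_def by (intro cusco_eqI[of a X b]) auto
    qed (auto simp: P_def)
  next
    fix C assume "C \<in> Chains (relation_of P S)"
    then have CS: "C \<subseteq> S" and tot: "\<And>a b. \<lbrakk>a \<in> C; b \<in> C\<rbrakk> \<Longrightarrow> P a b \<or> P b a"
      by (auto simp: Chains_def relation_of_def)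
    show "\<exists>u\<in>S. \<forall>a\<in>C. P a u"
    proof (cases "C = {}")
      case True
      then show ?thesis using \<Phi> by (auto simp: S_def)
    next
      case False
      define u where "u = (\<lambda>x\<in>topspace X. \<Inter>\<Psi>\<in>C. \<Psi> x)"
      have C: "\<Psi> \<in> cusco X" if "\<Psi> \<in> C" for \<Psi>
        using CS that by (auto simp: S_def)
      have inside: "\<exists>\<Psi>\<in>C. \<Psi> x \<subseteq> V" if x: "x \<in> topspace X" and V: "open V" "(\<Inter>\<Psi>\<in>C. \<Psi> x) \<subseteq> V" for x V
      proof (rule ccontr)
        assume no: "\<not> ?thesis"
        have "\<Inter>((\<lambda>\<Psi>. \<Psi> x - V) ` C) \<noteq> {}"
        proof (rule compact_chain)
          fix T assume "T \<in> (\<lambda>\<Psi>. \<Psi> x - V) ` C"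
          then obtain \<Psi> where "\<Psi> \<in> C" "T = \<Psi> x - V" by blast
          then show "compact T"
            using compact_diff[OF cusco_values(2)[OF C x] V(1)] by blast
        next
          show "{} \<notin> (\<lambda>\<Psi>. \<Psi> x - V) ` C" using no by auto
        next
          fix T T' assume "T \<in> (\<lambda>\<Psi>. \<Psi> x - V) ` C \<and> T' \<in> (\<lambda>\<Psi>. \<Psi> x - V) ` C"
          then show "T \<subseteq> T' \<or> T' \<subseteq> T"
            using tot x unfolding P_def by blast
        qed
        then show False using V(2) False by blast
      qed
      have "u \<in> cusco X"
      proof (rule cuscoI)
        show "u \<in> extensional (topspace X)" by (simp add: u_def)
      next
        fix x assume x: "x \<in> topspace X"
        have "(\<Inter>\<Psi>\<in>C. \<Psi> x) \<noteq> {}"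
          using inside[OF x open_empty] cusco_values(1)[OF C x] by auto
        moreover have "compact (\<Inter>\<Psi>\<in>C. \<Psi> x)"
          using cusco_values(2)[OF C x] False by (intro compact_Inter) auto
        moreover have "convex (\<Inter>\<Psi>\<in>C. \<Psi> x)"
          using cusco_values(3)[OF C x] by (intro convex_INT) auto
        ultimately show "u x \<noteq> {} \<and> compact (u x) \<and> convex (u x)"
          using x by (simp add: u_def)
      next
        fix x V assume x: "x \<in> topspace X" and V: "open V" "u x \<subseteq> V"
        then obtain \<Psi> where \<Psi>: "\<Psi> \<in> C" "\<Psi> x \<subseteq> V"
          using inside[OF x V(1)] by (auto simp: u_def)
        have "\<forall>z\<in>{z \<in> topspace X. \<Psi> z \<subseteq> V}. u z \<subseteq> V"
          using \<Psi>(1) by (auto simp: u_def)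
        then show "\<exists>N. openin X N \<and> x \<in> N \<and> (\<forall>z\<in>N. u z \<subseteq> V)"
          using openin_cusco[OF C[OF \<Psi>(1)] V(1)] x \<Psi>(2) by blast
      qed
      moreover have "u x \<subseteq> \<Phi> x" if x: "x \<in> topspace X" for x
        using x False CS by (force simp: u_def S_def)
      ultimately have "u \<in> S" by (simp add: S_def)
      moreover have "\<forall>a\<in>C. P a u" by (auto simp: P_def u_def)
      ultimately show ?thesis by blast
    qed
  qed
  then obtain m where m: "m \<in> S" "\<And>a. \<lbrakk>a \<in> S; P m a\<rbrakk> \<Longrightarrow> a = m" by blast
  have "m \<in> MC X"
    unfolding MC_iff
  proof (intro conjI ballI impI)
    fix \<Psi> x assume \<Psi>: "\<Psi> \<in> cusco X" "\<forall>x\<in>topspace X. \<Psi> x \<subseteq> m x" and "x \<in> topspace X"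
    have "\<Psi> \<in> S" using \<Psi> m(1) by (fastforce simp: S_def)
    then show "\<Psi> x = m x" using m(2)[of \<Psi>] \<Psi>(2) by (simp add: P_def)
  qed (use m(1) in \<open>simp add: S_def\<close>)
  then show thesis using that m(1) by (auto simp: S_def)
qed

text \<open>Minimality is inherited by open subspaces: a smaller cusco map on the open set \<open>W\<close>, continued
  by \<open>\<Phi>\<close> outside \<open>W\<close>, is still upper semicontinuous.\<close>

lemma MC_minimal_on_open:
  assumes \<Phi>: "\<Phi> \<in> MC X" and \<Psi>: "\<Psi> \<in> cusco X" and W: "openin X W"
    and sub: "\<And>x. x \<in> W \<Longrightarrow> \<Psi> x \<subseteq> \<Phi> x" and x: "x \<in> W"
  shows "\<Psi> x = \<Phi> x"
proof -
  have cu: "\<Phi> \<in> cusco X" using \<Phi> by (rule MC_imp_cusco)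
  have WX: "W \<subseteq> topspace X" using W by (rule openin_subset)
  define \<Theta> where "\<Theta> = (\<lambda>x\<in>topspace X. if x \<in> W then \<Psi> x else \<Phi> x)"
  have "\<Theta> \<in> cusco X"
  proof (rule cuscoI)
    fix z V assume z: "z \<in> topspace X" and V: "open V" "\<Theta> z \<subseteq> V"
    show "\<exists>N. openin X N \<and> z \<in> N \<and> (\<forall>y\<in>N. \<Theta> y \<subseteq> V)"
    proof (cases "z \<in> W")
      case True
      have "openin X (W \<inter> {y \<in> topspace X. \<Psi> y \<subseteq> V})"
        using W openin_cusco[OF \<Psi> V(1)] by blast
      then show ?thesis
        using True z V(2) by (intro exI[of _ "W \<inter> {y \<in> topspace X. \<Psi> y \<subseteq> V}"]) (auto simp: \<Theta>_def)
    next
      case False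
      have "\<forall>y\<in>{y \<in> topspace X. \<Phi> y \<subseteq> V}. \<Theta> y \<subseteq> V"
        using subset_trans[OF sub] by (auto simp: \<Theta>_def)
      then show ?thesis
        using openin_cusco[OF cu V(1)] False z V(2)
        by (intro exI[of _ "{y \<in> topspace X. \<Phi> y \<subseteq> V}"]) (auto simp: \<Theta>_def)
    qed
  qed (auto simp: \<Theta>_def cusco_values[OF \<Psi>] cusco_values[OF cu])
  moreover have "\<forall>y\<in>topspace X. \<Theta> y \<subseteq> \<Phi> y"
    using sub by (auto simp: \<Theta>_def)
  ultimately have "\<forall>y\<in>topspace X. \<Theta> y = \<Phi> y"
    using \<Phi> by (simp add: MC_iff)
  moreover have xX: "x \<in> topspace X" using x WX by blast
  ultimately have "\<Theta> x = \<Phi> x" by blast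
  then show ?thesis using x xX by (simp add: \<Theta>_def)
qed

lemma convex_subset_open_convex:
  fixes K V :: "real set"
  assumes "K \<noteq> {}" "convex K" "open V" "K \<subseteq> V"
  obtains V' where "open V'" "convex V'" "K \<subseteq> V'" "V' \<subseteq> V"
proof -
  obtain k where k: "k \<in> K" using assms(1) by blast
  show thesis
  proof
    show "open (connected_component_set V k)"
      using assms(3) by (rule open_connected_component)
    show "convex (connected_component_set V k)"
      using is_interval_connected_1 is_interval_convex_1 connected_connected_component by blast
    show "K \<subseteq> connected_component_set V k"
      using k assms by (intro connected_component_maximal convex_connected) auto
    show "connected_component_set V k \<subseteq> V"
      by (rule connected_component_subset)
  qed
qed

text \<open>This replaces the extension of continuous functions, for which regularity would be too weak.
  Separate \<open>x\<close> and \<open>A\<close> by open sets \<open>U\<close> and \<open>W\<close>, replace \<open>\<Phi>\<close> by the constant \<open>t\<close> on \<open>U\<close>, keep it on \<open>W\<close>, and elsewhere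
  take the convex hull of both values, which makes the result upper semicontinuous. A minimal map
  below it equals \<open>\<Phi>\<close> on \<open>W\<close>, because \<open>\<Phi>\<close> is already minimal there.\<close>

lemma MC_change_off_closed:
  assumes reg: "regular_space X" and \<Phi>: "\<Phi> \<in> MC X" and A: "closedin X A"
    and x: "x \<in> topspace X" "x \<notin> A"
  obtains \<Psi> where "\<Psi> \<in> MC X" "\<And>a. a \<in> A \<Longrightarrow> \<Psi> a = \<Phi> a" "\<Psi> x = {t}"
proof -
  obtain U W where U: "openin X U" "x \<in> U" and W: "openin X W" "A \<subseteq> W" and dis: "disjnt U W"
    using reg[unfolded regular_space_def, rule_format, of A x] A x by blast
  have cu: "\<Phi> \<in> cusco X" using \<Phi> by (rule MC_imp_cusco)
  define \<Theta> where "\<Theta> = (\<lambda>z\<in>topspace X. if z \<in> U then {t} else if z \<in> W then \<Phi> z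
                                      else convex hull (insert t (\<Phi> z)))"
  have "\<Theta> \<in> cusco X"
  proof (rule cuscoI)
    fix z assume z: "z \<in> topspace X"
    show "\<Theta> z \<noteq> {} \<and> compact (\<Theta> z) \<and> convex (\<Theta> z)"
      using cusco_values[OF cu z] z by (auto simp: \<Theta>_def intro!: compact_convex_hull)
  next
    fix z V assume z: "z \<in> topspace X" and V: "open V" "\<Theta> z \<subseteq> V"
    consider "z \<in> U" | "z \<in> W" "z \<notin> U" | "z \<notin> U" "z \<notin> W" by blast
    then show "\<exists>N. openin X N \<and> z \<in> N \<and> (\<forall>y\<in>N. \<Theta> y \<subseteq> V)"
    proof cases
      case 1
      then show ?thesis
        using U(1) V(2) z openin_subset[OF U(1)] by (intro exI[of _ U]) (auto simp: \<Theta>_def)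
    next
      case 2
      have "openin X (W \<inter> {y \<in> topspace X. \<Phi> y \<subseteq> V})"
        using W openin_cusco[OF cu V(1)] by blast
      then show ?thesis
        using 2 z V(2) dis
        by (intro exI[of _ "W \<inter> {y \<in> topspace X. \<Phi> y \<subseteq> V}"]) (auto simp: \<Theta>_def disjnt_iff)
    next
      case 3
      then have \<Theta>z: "\<Theta> z = convex hull (insert t (\<Phi> z))" using z by (simp add: \<Theta>_def)
      obtain V' where V': "open V'" "convex V'" "\<Theta> z \<subseteq> V'" "V' \<subseteq> V"
      proof (rule convex_subset_open_convex[of "\<Theta> z" V])
        show "\<Theta> z \<noteq> {}" "convex (\<Theta> z)" by (auto simp: \<Theta>z)
      qed (use V in auto)
      have t: "t \<in> V'" and \<Phi>z: "\<Phi> z \<subseteq> V'"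
        using V'(3) hull_subset[of "insert t (\<Phi> z)" convex] unfolding \<Theta>z by auto
      have "\<Theta> y \<subseteq> V" if y: "y \<in> topspace X" "\<Phi> y \<subseteq> V'" for y
      proof -
        have "convex hull (insert t (\<Phi> y)) \<subseteq> V'"
          using t y(2) V'(2) by (intro hull_minimal) auto
        then show ?thesis using t y V'(4) by (auto simp: \<Theta>_def)
      qed
      then show ?thesis
        using openin_cusco[OF cu V'(1)] \<Phi>z z
        by (intro exI[of _ "{y \<in> topspace X. \<Phi> y \<subseteq> V'}"]) auto
    qed
  qed (simp add: \<Theta>_def)
  then obtain \<Psi> where \<Psi>: "\<Psi> \<in> MC X" "\<And>z. z \<in> topspace X \<Longrightarrow> \<Psi> z \<subseteq> \<Theta> z"
    using minimal_cusco_below by blast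
  have "\<Psi> a = \<Phi> a" if "a \<in> A" for a
  proof (rule MC_minimal_on_open[OF \<Phi> MC_imp_cusco[OF \<Psi>(1)] W(1)])
    fix y assume y: "y \<in> W"
    then have "y \<in> topspace X" "y \<notin> U" using openin_subset[OF W(1)] dis by (auto simp: disjnt_iff)
    then show "\<Psi> y \<subseteq> \<Phi> y" using \<Psi>(2)[of y] y by (simp add: \<Theta>_def)
  qed (use that W(2) in blast)
  moreover have "\<Psi> x = {t}"
    using \<Psi>(2)[OF x(1)] cusco_values(1)[OF MC_imp_cusco[OF \<Psi>(1)] x(1)] U(2) x(1)
    by (auto simp: \<Theta>_def)
  ultimately show thesis using that \<Psi>(1) by blast
qed

lemma cusco_bounded_on_compact:
  assumes \<Phi>: "\<Phi> \<in> cusco X" and A: "compactin X A"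
  obtains M :: real where "\<And>x. x \<in> A \<Longrightarrow> \<Phi> x \<subseteq> ball 0 M"
proof -
  define V where "V = (\<lambda>n::nat. {x \<in> topspace X. \<Phi> x \<subseteq> ball 0 (real n)})"
  have "\<forall>U\<in>range V. openin X U"
    using openin_cusco[OF \<Phi>] by (auto simp: V_def)
  moreover have "A \<subseteq> \<Union>(range V)"
  proof
    fix x assume "x \<in> A"
    then have x: "x \<in> topspace X" using A compactin_subset_topspace by blast
    obtain B where B: "\<And>y. y \<in> \<Phi> x \<Longrightarrow> norm y \<le> B"
      using compact_imp_bounded[OF cusco_values(2)[OF \<Phi> x]] by (auto simp: bounded_iff)
    obtain n :: nat where "B < real n" using reals_Archimedean2 by blast
    then have "x \<in> V n" using x B by (force simp: V_def)
    then show "x \<in> \<Union>(range V)" by blast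
  qed
  ultimately obtain \<F> where \<F>: "finite \<F>" "\<F> \<subseteq> range V" "A \<subseteq> \<Union>\<F>"
    using A unfolding compactin_def by meson
  obtain I where I: "finite I" "\<F> = V ` I"
    using finite_subset_image[OF \<F>(1,2)] by blast
  have "\<Phi> x \<subseteq> ball 0 (real (Max (insert 0 I)))" if x: "x \<in> A" for x
  proof -
    obtain n where n: "n \<in> I" "x \<in> V n" using \<F>(3) I(2) x by blast
    then have "real n \<le> real (Max (insert 0 I))" using I(1) by simp
    then show ?thesis using n(2) by (auto simp: V_def)
  qed
  then show thesis using that by blast
qed

section \<open>Markov strategies, discrete selections and suprema of pseudometrics\<close>

text \<open>A Markov strategy amounts to a sequence of sets of admissible answers: for \<open>S n\<close> take all
  answers that the strategy can give in inning \<open>n\<close>. In this form strategies disappear, and a Markov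
  win becomes a statement about sets that meet every legal move.\<close>

lemma II_mark_G1_iff_answer_sets:
  "II_mark_G1 \<C> \<D> \<longleftrightarrow>
     (\<exists>S. (\<forall>n. \<forall>C\<in>\<C>. S n \<inter> C \<noteq> {}) \<and> (\<forall>s. (\<forall>n::nat. s n \<in> S n) \<longrightarrow> range s \<in> \<D>))"
proof
  assume "II_mark_G1 \<C> \<D>"
  then obtain \<sigma> where \<sigma>: "winning_markov_G1 \<C> \<D> \<sigma>" by (auto simp: II_mark_G1_def)
  define S where "S = (\<lambda>n. (\<lambda>C. \<sigma> C n) ` \<C>)"
  have "\<sigma> C n \<in> C" if "C \<in> \<C>" for C n
    using \<sigma>[unfolded winning_markov_G1_def, rule_format, of "\<lambda>_. C"] that by blast
  then have meets: "\<forall>n. \<forall>C\<in>\<C>. S n \<inter> C \<noteq> {}"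
    by (auto simp: S_def)
  have win: "range s \<in> \<D>" if "\<forall>n. s n \<in> S n" for s
  proof -
    have "\<forall>n. \<exists>C. C \<in> \<C> \<and> s n = \<sigma> C n" using that by (auto simp: S_def)
    then obtain C where C: "\<And>n. C n \<in> \<C>" "\<And>n. s n = \<sigma> (C n) n" by metis
    have "{\<sigma> (C n) n | n. True} \<in> \<D>"
      using \<sigma>[unfolded winning_markov_G1_def, rule_format, of C] C(1) by blast
    moreover have "{\<sigma> (C n) n | n. True} = range s" using C(2) by auto
    ultimately show ?thesis by simp
  qed
  show "\<exists>S. (\<forall>n. \<forall>C\<in>\<C>. S n \<inter> C \<noteq> {}) \<and> (\<forall>s. (\<forall>n::nat. s n \<in> S n) \<longrightarrow> range s \<in> \<D>)"
    by (rule exI[of _ S]) (simp add: meets win)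
next
  assume "\<exists>S. (\<forall>n. \<forall>C\<in>\<C>. S n \<inter> C \<noteq> {}) \<and> (\<forall>s. (\<forall>n::nat. s n \<in> S n) \<longrightarrow> range s \<in> \<D>)"
  then obtain S where S: "\<And>n C. C \<in> \<C> \<Longrightarrow> S n \<inter> C \<noteq> {}"
    "\<And>s. (\<And>n::nat. s n \<in> S n) \<Longrightarrow> range s \<in> \<D>" by blast
  define \<sigma> where "\<sigma> = (\<lambda>C n. SOME y. y \<in> S n \<inter> C)"
  have \<sigma>: "\<sigma> C n \<in> S n \<inter> C" if "C \<in> \<C>" for C n
    unfolding \<sigma>_def using S(1)[OF that, of n] by (rule some_in_eq[THEN iffD2])
  have "winning_markov_G1 \<C> \<D> \<sigma>"
    unfolding winning_markov_G1_def
  proof (intro allI impI conjI)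
    fix A :: "nat \<Rightarrow> _" assume A: "\<forall>n. A n \<in> \<C>"
    show "\<sigma> (A n) n \<in> A n" for n using \<sigma>[of "A n" n] A by blast
    have "range (\<lambda>n. \<sigma> (A n) n) \<in> \<D>"
      using S(2)[of "\<lambda>n. \<sigma> (A n) n"] \<sigma> A by blast
    then show "{\<sigma> (A n) n |n. True} \<in> \<D>"
      by (simp add: full_SetCompr_eq)
  qed
  then show "II_mark_G1 \<C> \<D>" by (auto simp: II_mark_G1_def)
qed

lemma II_mark_G1_mono:
  assumes "\<C>' \<subseteq> \<C>" "II_mark_G1 \<C> \<D>"
  shows "II_mark_G1 \<C>' \<D>"
  using assms unfolding II_mark_G1_iff_answer_sets by (meson subsetD)

lemma locally_finite_imp_closed_discrete:
  assumes "t1_space Y" and f: "\<And>n::nat. f n \<in> topspace Y"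
    and fin: "\<And>p. p \<in> topspace Y \<Longrightarrow> \<exists>U. openin Y U \<and> p \<in> U \<and> finite {n. f n \<in> U}"
  shows "closedin Y (range f)" "subtopology Y (range f) = discrete_topology (range f)"
proof -
  have "Y derived_set_of (range f) = {}"
  proof -
    have "p \<notin> Y derived_set_of (range f)" if p: "p \<in> topspace Y" for p
    proof -
      obtain U where U: "openin Y U" "p \<in> U" "finite {n. f n \<in> U}" using fin[OF p] by blast
      have "range f \<inter> U = f ` {n. f n \<in> U}" by auto
      then have "finite (range f \<inter> U)" using U(3) by simp
      then show ?thesis
        unfolding t1_space_derived_set_of_infinite_openin[THEN iffD1, rule_format, OF assms(1)]
        using U(1,2) by blast
    qed
    then show ?thesis using derived_set_of_subset_topspace by fastforce
  qed
  moreover have "range f \<subseteq> topspace Y" using f by blast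
  ultimately show "closedin Y (range f)" "subtopology Y (range f) = discrete_topology (range f)"
    by (simp_all add: closedin_contains_derived_set subtopology_eq_discrete_topology)
qed

text \<open>Choosing from punctured balls that shrink to a non-isolated point \<open>p\<close> always gives a sequence
  that accumulates at \<open>p\<close>.\<close>

lemma metrizable_imp_not_discretely_selective:
  assumes "metrizable_space Y" and p: "p \<in> topspace Y" and iso: "\<not> openin Y {p}"
  shows "\<not> discretely_selective Y"
proof
  assume sel: "discretely_selective Y"
  obtain M d where "Metric_space M d" and Y: "Y = Metric_space.mtopology M d"
    using assms(1) by (auto simp: metrizable_space_def)
  then interpret Metric_space M d by simp
  have pM: "p \<in> M" using p Y by simp
  define U where "U = (\<lambda>n. mball p (inverse (real (Suc n))) - {p})"
  have "openin Y (U n)" for n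
    using pM unfolding U_def Y by (intro openin_diff closedin_Hausdorff_singleton) (auto simp: Hausdorff_space_mtopology)
  moreover have "U n \<noteq> {}" for n
  proof
    assume "U n = {}"
    then have "mball p (inverse (real (Suc n))) = {p}" using pM by (auto simp: U_def)
    then show False using iso openin_mball Y by metis
  qed
  ultimately obtain y where y: "\<And>n. y n \<in> U n" and cl: "closedin Y (range y)"
    using sel[unfolded discretely_selective_def, rule_format, of U] by blast
  have "openin mtopology (M - range y)" using cl Y by (simp add: closedin_def)
  moreover have "p \<in> M - range y" using pM y by (auto simp: U_def)
  ultimately obtain r where r: "r > 0" "mball p r \<subseteq> M - range y"
    unfolding openin_mtopology by blast
  obtain n where n: "inverse (real (Suc n)) < r" using reals_Archimedean r(1) by blast
  have "y n \<in> mball p (inverse (real (Suc n)))" using y[of n] by (simp add: U_def)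
  then have "y n \<in> mball p r" using n by (simp add: in_mball)
  then show False using r(2) by blast
qed

lemma Metric_space_SUP:
  fixes d :: "'i \<Rightarrow> 'b \<Rightarrow> 'b \<Rightarrow> real"
  assumes I: "I \<noteq> {}"
    and nonneg: "\<And>i x y. 0 \<le> d i x y" and bounded: "\<And>i x y. d i x y \<le> B"
    and commute: "\<And>i x y. d i x y = d i y x" and self: "\<And>i x. d i x x = 0"
    and triangle: "\<And>i x y z. d i x z \<le> d i x y + d i y z"
    and separated: "\<And>x y. \<lbrakk>x \<in> M; y \<in> M; x \<noteq> y\<rbrakk> \<Longrightarrow> \<exists>i\<in>I. d i x y > 0"
  shows "Metric_space M (\<lambda>x y. SUP i\<in>I. d i x y)"
proof
  have bdd: "bdd_above ((\<lambda>i. d i x y) ` I)" for x y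
    using bounded by (intro bdd_aboveI2)
  have upper: "d i x y \<le> (SUP i\<in>I. d i x y)" if "i \<in> I" for i x y
    using that bdd by (rule cSUP_upper)
  show nn: "0 \<le> (SUP i\<in>I. d i x y)" for x y
  proof -
    obtain i where "i \<in> I" using I by blast
    then show ?thesis using nonneg[of i x y] upper[of i x y] by linarith
  qed
  show "(SUP i\<in>I. d i x y) = (SUP i\<in>I. d i y x)" for x y
    by (simp add: commute)
  show "(SUP i\<in>I. d i x y) = 0 \<longleftrightarrow> x = y" if xy: "x \<in> M" "y \<in> M" for x y
  proof
    assume 0: "(SUP i\<in>I. d i x y) = 0"
    show "x = y"
    proof (rule ccontr)
      assume "x \<noteq> y"
      then obtain i where "i \<in> I" "d i x y > 0" using separated xy by blast
      then show False using upper[of i x y] 0 by linarith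
    qed
  qed (use I self in simp)
  show "(SUP i\<in>I. d i x z) \<le> (SUP i\<in>I. d i x y) + (SUP i\<in>I. d i y z)" for x y z
  proof (rule cSUP_least[OF I])
    fix i assume i: "i \<in> I"
    show "d i x z \<le> (SUP i\<in>I. d i x y) + (SUP i\<in>I. d i y z)"
      using triangle[of i x z y] upper[OF i, of x y] upper[OF i, of y z] by linarith
  qed
qed

section \<open>Spaces of minimal cusco maps\<close>

text \<open>Finite sets and compact sets are treated at once: both form a family of non-empty compact
  sets that contains the singletons and is closed under binary unions.\<close>

definition countable_cofinality :: "'a set set \<Rightarrow> bool" where
  "countable_cofinality \<A> \<longleftrightarrow> (\<exists>A :: nat \<Rightarrow> 'a set. (\<forall>n. A n \<in> \<A>) \<and> (\<forall>B\<in>\<A>. \<exists>n. B \<subseteq> A n))"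

definition family_covers :: "'a topology \<Rightarrow> 'a set set \<Rightarrow> 'a set set set" where
  "family_covers X \<A> =
     {\<U>. (\<forall>U\<in>\<U>. openin X U) \<and> \<Union>\<U> = topspace X \<and> {} \<notin> \<U> \<and> topspace X \<notin> \<U> \<and>
          (\<forall>A\<in>\<A>. \<exists>U\<in>\<U>. A \<subseteq> U)}"

locale compact_family =
  fixes X :: "'a topology" and \<A> :: "'a set set"
  assumes regular: "regular_space X" and Hausdorff: "Hausdorff_space X"
    and compact: "A \<in> \<A> \<Longrightarrow> compactin X A" and nonempty: "A \<in> \<A> \<Longrightarrow> A \<noteq> {}"
    and singleton: "x \<in> topspace X \<Longrightarrow> {x} \<in> \<A>"
    and union: "\<lbrakk>A \<in> \<A>; B \<in> \<A>\<rbrakk> \<Longrightarrow> A \<union> B \<in> \<A>"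
    and space_nonempty: "topspace X \<noteq> {}"
begin

abbreviation Y where "Y \<equiv> MC_topology X \<A>"

lemma subset_topspace: "A \<in> \<A> \<Longrightarrow> A \<subseteq> topspace X"
  using compact compactin_subset_topspace by blast

lemma closed: "A \<in> \<A> \<Longrightarrow> closedin X A"
  using compact Hausdorff compactin_imp_closedin by blast

lemma openin_Y:
  "openin Y U \<longleftrightarrow> U \<subseteq> MC X \<and> (\<forall>\<Phi>\<in>U. \<exists>A\<in>\<A>. \<exists>\<epsilon>>0. MC_entourage X A \<epsilon> `` {\<Phi>} \<subseteq> U)"
proof (rule openin_MC_topology)
  fix A B assume "A \<in> \<A>" "B \<in> \<A>"
  then show "\<exists>C\<in>\<A>. A \<union> B \<subseteq> C" using union[of A B] by blast
qed

lemma topspace_Y [simp]: "topspace Y = MC X"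
proof (rule topspace_MC_topology)
  fix A B assume "A \<in> \<A>" "B \<in> \<A>"
  then show "\<exists>C\<in>\<A>. A \<union> B \<subseteq> C" using union[of A B] by blast
next
  show "\<A> \<noteq> {}" using space_nonempty singleton by blast
qed

lemma entourage_iff:
  assumes "A \<in> \<A>"
  shows "(\<Phi>, \<Psi>) \<in> MC_entourage X A \<epsilon> \<longleftrightarrow>
           \<Phi> \<in> MC X \<and> \<Psi> \<in> MC X \<and> (\<forall>x\<in>A. endpoint_dist (\<Phi> x) (\<Psi> x) < \<epsilon>)"
proof -
  have "\<Phi> x \<subseteq> (\<Union>y\<in>\<Psi> x. ball y \<epsilon>) \<and> \<Psi> x \<subseteq> (\<Union>y\<in>\<Phi> x. ball y \<epsilon>) \<longleftrightarrow> endpoint_dist (\<Phi> x) (\<Psi> x) < \<epsilon>"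
    if "\<Phi> \<in> MC X" "\<Psi> \<in> MC X" "x \<in> A" for x
  proof -
    have "x \<in> topspace X" using that(3) subset_topspace[OF assms] by blast
    then show ?thesis
      using cusco_values[OF MC_imp_cusco[OF that(1)]] cusco_values[OF MC_imp_cusco[OF that(2)]]
      by (intro endpoint_dist_less_iff)
  qed
  then show ?thesis unfolding MC_entourage_def by auto
qed

lemma MC_separated:
  assumes "\<Phi> \<in> MC X" "\<Psi> \<in> MC X" "\<Phi> \<noteq> \<Psi>"
  obtains x where "x \<in> topspace X" "endpoint_dist (\<Phi> x) (\<Psi> x) > 0"
proof -
  note cu = assms(1,2)[THEN MC_imp_cusco]
  obtain x where x: "x \<in> topspace X" "\<Phi> x \<noteq> \<Psi> x" using cusco_eqI[OF cu] assms(3) by blast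
  have "endpoint_dist (\<Phi> x) (\<Psi> x) \<noteq> 0"
    using endpoint_dist_eq_0_imp_eq[OF cusco_values[OF cu(1) x(1)] cusco_values[OF cu(2) x(1)]] x(2)
    by blast
  then show thesis using that x(1) endpoint_dist_nonneg[of "\<Phi> x" "\<Psi> x"] by force
qed

lemma open_nhd_in_entourage:
  assumes \<Phi>: "\<Phi> \<in> MC X" and A: "A \<in> \<A>" and \<epsilon>: "\<epsilon> > 0"
  obtains U where "openin Y U" "\<Phi> \<in> U" "U \<subseteq> MC_entourage X A \<epsilon> `` {\<Phi>}"
proof
  let ?U = "\<Union>\<delta>\<in>{0<..<\<epsilon>}. MC_entourage X A \<delta> `` {\<Phi>}"
  have "\<exists>A\<in>\<A>. \<exists>\<eta>>0. MC_entourage X A \<eta> `` {\<Psi>} \<subseteq> ?U" if "\<Psi> \<in> ?U" for \<Psi>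
  proof -
    have "\<Psi> \<in> ?U" by (fact that)
    obtain \<delta> where \<delta>: "0 < \<delta>" "\<delta> < \<epsilon>" "(\<Phi>, \<Psi>) \<in> MC_entourage X A \<delta>"
    proof -
      obtain \<delta> where "\<delta> \<in> {0<..<\<epsilon>}" "\<Psi> \<in> MC_entourage X A \<delta> `` {\<Phi>}" using \<open>\<Psi> \<in> ?U\<close> by (rule UN_E)
      then show thesis using that[of \<delta>] by simp
    qed
    define \<eta> where "\<eta> = (\<epsilon> - \<delta>) / 2"
    have \<eta>: "\<eta> > 0" "\<delta> + \<eta> \<in> {0<..<\<epsilon>}" using \<delta> by (auto simp: \<eta>_def field_simps)
    have "(\<Phi>, \<Theta>) \<in> MC_entourage X A (\<delta> + \<eta>)" if \<Theta>: "(\<Psi>, \<Theta>) \<in> MC_entourage X A \<eta>" for \<Theta>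
    proof -
      have "endpoint_dist (\<Phi> x) (\<Theta> x) < \<delta> + \<eta>" if "x \<in> A" for x
        using \<delta>(3) \<Theta> that endpoint_dist_triangle[of "\<Phi> x" "\<Theta> x" "\<Psi> x"]
        unfolding entourage_iff[OF A] by fastforce
      then show ?thesis using \<delta>(3) \<Theta> unfolding entourage_iff[OF A] by blast
    qed
    then have "MC_entourage X A \<eta> `` {\<Psi>} \<subseteq> ?U" using \<eta>(2) by blast
    then show ?thesis using A \<eta>(1) by blast
  qed
  then show "openin Y ?U"
    unfolding openin_Y by (auto simp: MC_entourage_def)
  have "(\<Phi>, \<Phi>) \<in> MC_entourage X A (\<epsilon>/2)"
    using \<Phi> \<epsilon> by (simp add: entourage_iff[OF A])
  moreover have "\<epsilon>/2 \<in> {0<..<\<epsilon>}" using \<epsilon> by simp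
  ultimately show "\<Phi> \<in> ?U" by blast
  show "?U \<subseteq> MC_entourage X A \<epsilon> `` {\<Phi>}"
    by (intro UN_least Image_mono MC_entourage_mono) auto
qed

lemma closure_iff:
  assumes "\<Phi> \<in> MC X"
  shows "\<Phi> \<in> Y closure_of S \<longleftrightarrow> (\<forall>A\<in>\<A>. \<forall>\<epsilon>>0. \<exists>\<Psi>\<in>S. (\<Phi>, \<Psi>) \<in> MC_entourage X A \<epsilon>)"
proof
  assume cl: "\<Phi> \<in> Y closure_of S"
  show "\<forall>A\<in>\<A>. \<forall>\<epsilon>>0. \<exists>\<Psi>\<in>S. (\<Phi>, \<Psi>) \<in> MC_entourage X A \<epsilon>"
  proof (intro ballI allI impI)
    fix A \<epsilon> assume "A \<in> \<A>" "0 < (\<epsilon>::real)"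
    then obtain U where U: "openin Y U" "\<Phi> \<in> U" "U \<subseteq> MC_entourage X A \<epsilon> `` {\<Phi>}"
      using open_nhd_in_entourage[OF assms] by blast
    then obtain \<Psi> where "\<Psi> \<in> S" "\<Psi> \<in> U" using cl by (auto simp: in_closure_of)
    then show "\<exists>\<Psi>\<in>S. (\<Phi>, \<Psi>) \<in> MC_entourage X A \<epsilon>" using U(3) by blast
  qed
next
  assume near: "\<forall>A\<in>\<A>. \<forall>\<epsilon>>0. \<exists>\<Psi>\<in>S. (\<Phi>, \<Psi>) \<in> MC_entourage X A \<epsilon>"
  have "\<exists>\<Psi>. \<Psi> \<in> S \<and> \<Psi> \<in> T" if T: "\<Phi> \<in> T" "openin Y T" for T
  proof -
    obtain A \<epsilon> where A: "A \<in> \<A>" "0 < \<epsilon>" "MC_entourage X A \<epsilon> `` {\<Phi>} \<subseteq> T"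
      using T unfolding openin_Y by blast
    then obtain \<Psi> where "\<Psi> \<in> S" "(\<Phi>, \<Psi>) \<in> MC_entourage X A \<epsilon>" using near by blast
    then show ?thesis using A(3) by blast
  qed
  then show "\<Phi> \<in> Y closure_of S" using assms by (auto simp: in_closure_of)
qed

lemma t1_space_Y: "t1_space Y"
  unfolding t1_space_def topspace_Y
proof (intro ballI impI)
  fix \<Phi> \<Psi> assume MC: "\<Phi> \<in> MC X" "\<Psi> \<in> MC X" "\<Phi> \<noteq> \<Psi>"
  obtain x where x: "x \<in> topspace X" "endpoint_dist (\<Phi> x) (\<Psi> x) > 0"
    using MC_separated[OF MC] .
  obtain U where U: "openin Y U" "\<Phi> \<in> U" "U \<subseteq> MC_entourage X {x} (endpoint_dist (\<Phi> x) (\<Psi> x)) `` {\<Phi>}"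
    using open_nhd_in_entourage[OF MC(1) singleton[OF x(1)] x(2)] .
  have "\<Psi> \<notin> U"
  proof
    assume "\<Psi> \<in> U"
    then have "(\<Phi>, \<Psi>) \<in> MC_entourage X {x} (endpoint_dist (\<Phi> x) (\<Psi> x))" using U(3) by blast
    then show False by (simp add: entourage_iff[OF singleton[OF x(1)]])
  qed
  then show "\<exists>U. openin Y U \<and> \<Phi> \<in> U \<and> \<Psi> \<notin> U" using U by blast
qed

text \<open>Non-zero constant maps come arbitrarily close to the zero map.\<close>

lemma MC_zero_not_isolated: "\<not> openin Y {MC_zero X}"
proof
  assume "openin Y {MC_zero X}"
  then obtain A \<epsilon> where A: "A \<in> \<A>" "0 < \<epsilon>" "MC_entourage X A \<epsilon> `` {MC_zero X} \<subseteq> {MC_zero X}"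
    unfolding openin_Y by blast
  let ?c = "\<lambda>x\<in>topspace X. {\<epsilon>/2}"
  have "(MC_zero X, ?c) \<in> MC_entourage X A \<epsilon>"
    using A(1,2) subset_topspace[OF A(1)] constant_in_MC[of "\<epsilon>/2" X] MC_zero_in_MC[of X]
    by (auto simp: entourage_iff MC_zero_def endpoint_dist_def subset_iff)
  then have "?c = MC_zero X" using A(3) by blast
  moreover obtain x where "x \<in> topspace X" using space_nonempty by blast
  ultimately have "{\<epsilon>/2} = {0}" by (metis MC_zero_def restrict_apply')
  then show False using A(2) by simp
qed

text \<open>Points \<open>x n \<in> B - A n\<close> are invisible to neighbourhoods that restrict maps on \<open>A n\<close> only, so the
  values there can be prescribed. All these points lie in one compact set \<open>B\<close>, on which a single
  neighbourhood of any map controls all of them.\<close>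

lemma prescribe_outside:
  assumes B: "B \<in> \<A>" and A: "\<And>n::nat. A n \<in> \<A>" and esc: "\<And>n. \<not> B \<subseteq> A n"
    and \<Phi>: "\<And>n. \<Phi> n \<in> MC X" and \<epsilon>: "\<And>n. \<epsilon> n > 0"
  shows "\<exists>x \<Psi>. \<forall>n. x n \<in> B \<and> \<Psi> n (x n) = {t n} \<and> (\<Phi> n, \<Psi> n) \<in> MC_entourage X (A n) (\<epsilon> n)"
proof -
  have "\<exists>\<Psi> x. x \<in> B \<and> \<Psi> x = {t n} \<and> (\<Phi> n, \<Psi>) \<in> MC_entourage X (A n) (\<epsilon> n)" for n
  proof -
    obtain x where x: "x \<in> B" "x \<notin> A n" using esc by blast
    have xX: "x \<in> topspace X" using x(1) subset_topspace[OF B] by blast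
    obtain \<Psi> where \<Psi>: "\<Psi> \<in> MC X" "\<And>a. a \<in> A n \<Longrightarrow> \<Psi> a = \<Phi> n a" "\<Psi> x = {t n}"
      using MC_change_off_closed[OF regular \<Phi>[of n] closed[OF A] xX x(2), of "t n"] by blast
    have "(\<Phi> n, \<Psi>) \<in> MC_entourage X (A n) (\<epsilon> n)"
      using \<Psi>(1,2) \<Phi>[of n] \<epsilon>[of n] by (simp add: entourage_iff[OF A])
    then show ?thesis using x(1) \<Psi>(3) by blast
  qed
  then show ?thesis by metis
qed

lemma not_countable_cofinality_escape:
  assumes "\<not> countable_cofinality \<A>" "\<And>n::nat. A n \<in> \<A>"
  obtains B where "B \<in> \<A>" "\<And>n. \<not> B \<subseteq> A n"
  using assms unfolding countable_cofinality_def by metis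

lemma countable_cofinality_increasing:
  assumes "countable_cofinality \<A>"
  obtains A :: "nat \<Rightarrow> 'a set"
  where "\<And>n. A n \<in> \<A>" "mono A" "\<And>B. B \<in> \<A> \<Longrightarrow> \<exists>n. B \<subseteq> A n"
proof -
  obtain C :: "nat \<Rightarrow> 'a set" where C: "\<And>n. C n \<in> \<A>" "\<And>B. B \<in> \<A> \<Longrightarrow> \<exists>n. B \<subseteq> C n"
    using assms unfolding countable_cofinality_def by metis
  define A where "A = (\<lambda>n. \<Union>k\<le>n. C k)"
  have "A n \<in> \<A>" for n
  proof (induction n)
    case 0
    then show ?case using C(1)[of 0] by (simp add: A_def)
  next
    case (Suc n)
    have "A (Suc n) = A n \<union> C (Suc n)" by (auto simp: A_def atMost_Suc)
    then show ?case using union[OF Suc C(1)] by simp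
  qed
  moreover have "mono A" unfolding A_def by (intro monoI UN_mono) auto
  moreover have "\<exists>n. B \<subseteq> A n" if "B \<in> \<A>" for B
    using C(2)[OF that] unfolding A_def by blast
  ultimately show thesis using that by blast
qed

text \<open>Discrete selections exist when no sequence of the family is cofinal: prescribe the value \<open>n\<close> for
  the \<open>n\<close>th map at some point of a fixed compact set. Every cusco map is bounded on that set, hence
  close there to only finitely many of the chosen maps.\<close>

lemma discretely_selective_Y:
  assumes "\<not> countable_cofinality \<A>"
  shows "discretely_selective Y"
  unfolding discretely_selective_def
proof (intro allI impI)
  fix U :: "nat \<Rightarrow> ('a \<Rightarrow> real set) set" assume U: "\<forall>n. openin Y (U n) \<and> U n \<noteq> {}"
  have "\<exists>\<Phi> A \<epsilon>. \<Phi> \<in> MC X \<and> A \<in> \<A> \<and> 0 < \<epsilon> \<and> MC_entourage X A \<epsilon> `` {\<Phi>} \<subseteq> U n" for n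
  proof -
    obtain \<Phi> where "\<Phi> \<in> U n" using U by blast
    then show ?thesis using U[rule_format, of n] unfolding openin_Y by blast
  qed
  then obtain \<Phi> A \<epsilon> where \<Phi>: "\<And>n. \<Phi> n \<in> MC X" and A: "\<And>n. A n \<in> \<A>" and \<epsilon>: "\<And>n. 0 < (\<epsilon> n :: real)"
    and sub: "\<And>n. MC_entourage X (A n) (\<epsilon> n) `` {\<Phi> n} \<subseteq> U n" by metis
  obtain B where B: "B \<in> \<A>" "\<And>n. \<not> B \<subseteq> A n"
    using not_countable_cofinality_escape[OF assms, of A] A by blast
  obtain x y where x: "\<And>n. x n \<in> B" and y: "\<And>n. y n (x n) = {real n}"
    and ent: "\<And>n. (\<Phi> n, y n) \<in> MC_entourage X (A n) (\<epsilon> n)"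
    using prescribe_outside[where A = A and \<Phi> = \<Phi> and \<epsilon> = \<epsilon> and t = real, OF B(1) A B(2) \<Phi> \<epsilon>]
    by metis
  have yU: "y n \<in> U n" for n using ent sub by blast
  have yMC: "y n \<in> MC X" for n using ent[of n] by (simp add: MC_entourage_def)
  have fin: "\<exists>V. openin Y V \<and> \<Psi> \<in> V \<and> finite {n. y n \<in> V}" if \<Psi>: "\<Psi> \<in> topspace Y" for \<Psi>
  proof -
    have \<Psi>MC: "\<Psi> \<in> MC X" using \<Psi> by simp
    obtain M where M: "\<And>x. x \<in> B \<Longrightarrow> \<Psi> x \<subseteq> ball 0 M"
      using cusco_bounded_on_compact[OF MC_imp_cusco[OF \<Psi>MC] compact[OF B(1)]] by blast
    obtain V where V: "openin Y V" "\<Psi> \<in> V" "V \<subseteq> MC_entourage X B 1 `` {\<Psi>}"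
      using open_nhd_in_entourage[OF \<Psi>MC B(1) zero_less_one] .
    obtain N :: nat where N: "M + 1 < real N" using reals_Archimedean2 by blast
    have "n \<le> N" if "y n \<in> V" for n
    proof -
      have "(\<Psi>, y n) \<in> MC_entourage X B 1" using V(3) that by blast
      then have "y n (x n) \<subseteq> (\<Union>z\<in>\<Psi> (x n). ball z 1)" using x[of n] by (simp add: MC_entourage_def)
      then obtain z where z: "z \<in> \<Psi> (x n)" "real n \<in> ball z 1" unfolding y by blast
      then have "z \<in> ball 0 M" using M[OF x[of n]] by blast
      then show ?thesis using z(2) N by (auto simp: dist_real_def)
    qed
    then have "{n. y n \<in> V} \<subseteq> {..N}" by auto
    then show ?thesis using V finite_subset by blast
  qed
  show "\<exists>y. (\<forall>n. y n \<in> U n) \<and> closedin Y (range y) \<and>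
              subtopology Y (range y) = discrete_topology (range y)"
    using locally_finite_imp_closed_discrete[where f = y, OF t1_space_Y _ fin] yMC yU by auto
qed

text \<open>A cofinal increasing sequence \<open>A n\<close> makes the uniformity countably generated. Truncating the
  distance over \<open>A n\<close> at \<open>1/(n+1)\<close> allows a single supremum as the metric: for a given radius only
  finitely many \<open>n\<close> matter, and the largest of them controls the others since \<open>A\<close> increases.\<close>

lemma metrizable_Y:
  assumes "countable_cofinality \<A>"
  shows "metrizable_space Y"
proof -
  obtain A :: "nat \<Rightarrow> 'a set" where A: "\<And>n. A n \<in> \<A>" "mono A" "\<And>B. B \<in> \<A> \<Longrightarrow> \<exists>n. B \<subseteq> A n"
    using countable_cofinality_increasing[OF assms] by metis
  define I where "I = Sigma UNIV A"
  define d :: "nat \<times> 'a \<Rightarrow> ('a \<Rightarrow> real set) \<Rightarrow> ('a \<Rightarrow> real set) \<Rightarrow> real"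
    where "d = (\<lambda>(n, x) \<Phi> \<Psi>. min (inverse (real (Suc n))) (endpoint_dist (\<Phi> x) (\<Psi> x)))"
  define D where "D = (\<lambda>\<Phi> \<Psi>. SUP i\<in>I. d i \<Phi> \<Psi>)"
  have inv1: "inverse (real (Suc n)) \<le> 1" for n by (simp add: field_simps)
  have dnn: "0 \<le> d i \<Phi> \<Psi>" and db: "d i \<Phi> \<Psi> \<le> 1" for i \<Phi> \<Psi>
    using endpoint_dist_nonneg inv1 by (auto simp: d_def min_le_iff_disj split: prod.split)
  have Ine: "I \<noteq> {}" using nonempty[OF A(1)] by (auto simp: I_def)
  have upper: "d i \<Phi> \<Psi> \<le> D \<Phi> \<Psi>" if "i \<in> I" for i \<Phi> \<Psi>
    unfolding D_def using that db by (intro cSUP_upper bdd_aboveI2)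
  have "Metric_space (MC X) D"
    unfolding D_def
  proof (rule Metric_space_SUP[OF Ine dnn db])
    show "d i \<Phi> \<Psi> = d i \<Psi> \<Phi>" for i \<Phi> \<Psi> by (simp add: d_def endpoint_dist_commute split: prod.split)
    show "d i \<Phi> \<Phi> = 0" for i \<Phi> by (simp add: d_def split: prod.split)
    show "d i \<Phi> \<Theta> \<le> d i \<Phi> \<Psi> + d i \<Psi> \<Theta>" for i \<Phi> \<Psi> \<Theta>
    proof -
      have "min c (endpoint_dist K M) \<le> min c (endpoint_dist K L) + min c (endpoint_dist L M)"
        if "c \<ge> 0" for c K L M
        using that endpoint_dist_triangle[of K M L] endpoint_dist_nonneg[of K L] endpoint_dist_nonneg[of L M]
        by (auto simp: min_def)
      then show ?thesis by (simp add: d_def split: prod.split)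
    qed
    show "\<exists>i\<in>I. 0 < d i \<Phi> \<Psi>" if MC: "\<Phi> \<in> MC X" "\<Psi> \<in> MC X" "\<Phi> \<noteq> \<Psi>" for \<Phi> \<Psi>
    proof -
      obtain x where x: "x \<in> topspace X" "endpoint_dist (\<Phi> x) (\<Psi> x) > 0" using MC_separated[OF MC] .
      obtain n where "{x} \<subseteq> A n" using A(3) singleton[OF x(1)] by blast
      then have "(n, x) \<in> I" "0 < d (n, x) \<Phi> \<Psi>" using x(2) by (auto simp: I_def d_def)
      then show ?thesis by blast
    qed
  qed
  then interpret D: Metric_space "MC X" D .
  have ball_in_entourage: "\<exists>r>0. D.mball \<Phi> r \<subseteq> MC_entourage X B \<epsilon> `` {\<Phi>}" if B: "B \<in> \<A>" and \<epsilon>: "\<epsilon> > 0" for \<Phi> B \<epsilon>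
  proof -
    obtain n where n: "B \<subseteq> A n" using A(3)[OF B] by blast
    define r where "r = min \<epsilon> (inverse (real (Suc n)))"
    have "(\<Phi>, \<Psi>) \<in> MC_entourage X B \<epsilon>" if \<Psi>: "\<Psi> \<in> D.mball \<Phi> r" for \<Psi>
    proof -
      have "endpoint_dist (\<Phi> x) (\<Psi> x) < \<epsilon>" if "x \<in> B" for x
      proof -
        have "(n, x) \<in> I" using n that by (auto simp: I_def)
        then have "d (n, x) \<Phi> \<Psi> < r" using upper[of "(n, x)" \<Phi> \<Psi>] \<Psi> by simp
        then show ?thesis by (auto simp: d_def r_def min_def split: if_splits)
      qed
      then show ?thesis using \<Psi> by (simp add: entourage_iff[OF B])
    qed
    moreover have "r > 0" using \<epsilon> by (simp add: r_def)
    ultimately show ?thesis by blast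
  qed
  have entourage_in_ball: "\<exists>n. MC_entourage X (A n) (r/2) `` {\<Phi>} \<subseteq> D.mball \<Phi> r" if r: "r > 0" for \<Phi> r
  proof -
    obtain n where n: "inverse (real (Suc n)) < r/2" using reals_Archimedean[of "r/2"] r by auto
    have "\<Psi> \<in> D.mball \<Phi> r" if \<Psi>: "(\<Phi>, \<Psi>) \<in> MC_entourage X (A n) (r/2)" for \<Psi>
    proof -
      have "D \<Phi> \<Psi> \<le> r/2"
        unfolding D_def
      proof (rule cSUP_least[OF Ine])
        fix i assume "i \<in> I"
        then obtain m x where i: "i = (m, x)" and x: "x \<in> A m" by (auto simp: I_def)
        show "d i \<Phi> \<Psi> \<le> r/2"
        proof (cases "m \<le> n")
          case True
          then have "x \<in> A n" using x monoD[OF A(2)] by blast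
          then have "endpoint_dist (\<Phi> x) (\<Psi> x) < r/2" using \<Psi> by (simp add: entourage_iff[OF A(1)])
          then show ?thesis by (simp add: i d_def)
        next
          case False
          then have "inverse (real (Suc m)) \<le> inverse (real (Suc n))" by (simp add: field_simps)
          then have "inverse (real (Suc m)) \<le> r/2" using n by linarith
          then show ?thesis unfolding i d_def by (simp del: of_nat_Suc add: min.coboundedI1)
        qed
      qed
      then show ?thesis using \<Psi> r by (simp add: entourage_iff[OF A(1)])
    qed
    then show ?thesis by blast
  qed
  have "Y = D.mtopology"
    unfolding topology_eq
  proof
    fix U
    have "(\<exists>B\<in>\<A>. \<exists>\<epsilon>>0. MC_entourage X B \<epsilon> `` {\<Phi>} \<subseteq> U) \<longleftrightarrow> (\<exists>r>0. D.mball \<Phi> r \<subseteq> U)" for \<Phi>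
    proof
      assume "\<exists>B\<in>\<A>. \<exists>\<epsilon>>0. MC_entourage X B \<epsilon> `` {\<Phi>} \<subseteq> U"
      then show "\<exists>r>0. D.mball \<Phi> r \<subseteq> U" using ball_in_entourage by (meson order_trans)
    next
      assume "\<exists>r>0. D.mball \<Phi> r \<subseteq> U"
      then obtain r where r: "r > 0" "D.mball \<Phi> r \<subseteq> U" by blast
      then obtain n where "MC_entourage X (A n) (r/2) `` {\<Phi>} \<subseteq> U"
        using entourage_in_ball[OF r(1), of \<Phi>] by (meson order_trans)
      then show "\<exists>B\<in>\<A>. \<exists>\<epsilon>>0. MC_entourage X B \<epsilon> `` {\<Phi>} \<subseteq> U" using A(1)[of n] r(1) half_gt_zero by blast
    qed
    then show "openin Y U \<longleftrightarrow> openin D.mtopology U"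
      unfolding openin_Y D.openin_mtopology by (simp add: Ball_def)
  qed
  then show ?thesis using D.metrizable_space_mtopology by simp
qed

text \<open>It is enough to absorb \<open>A n\<close> in inning \<open>n\<close>, for a cofinal sequence \<open>A n\<close>.\<close>

lemma II_mark_covers:
  assumes "countable_cofinality \<A>"
  shows "II_mark_G1 (family_covers X \<A>) (family_covers X \<A>)"
proof -
  obtain A :: "nat \<Rightarrow> 'a set" where A: "\<And>n. A n \<in> \<A>" "\<And>B. B \<in> \<A> \<Longrightarrow> \<exists>n. B \<subseteq> A n"
    using assms unfolding countable_cofinality_def by metis
  define S where "S = (\<lambda>n. {U. openin X U \<and> U \<noteq> {} \<and> U \<noteq> topspace X \<and> A n \<subseteq> U})"
  have "S n \<inter> \<U> \<noteq> {}" if \<U>: "\<U> \<in> family_covers X \<A>" for n \<U>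
  proof -
    obtain U where "U \<in> \<U>" "A n \<subseteq> U" using \<U> A(1)[of n] by (auto simp: family_covers_def)
    then have "U \<in> S n \<inter> \<U>" using \<U> by (auto simp: family_covers_def S_def)
    then show ?thesis by blast
  qed
  moreover have "range s \<in> family_covers X \<A>" if s: "\<forall>n. s n \<in> S n" for s
  proof -
    have absorb: "\<exists>n. B \<subseteq> s n" if "B \<in> \<A>" for B
    proof -
      obtain n where "B \<subseteq> A n" using A(2)[OF \<open>B \<in> \<A>\<close>] by blast
      then have "B \<subseteq> s n" using s[rule_format, of n] by (auto simp: S_def)
      then show ?thesis by blast
    qed
    have "topspace X \<subseteq> \<Union>(range s)"
    proof
      fix x assume "x \<in> topspace X"
      then show "x \<in> \<Union>(range s)" using absorb[OF singleton] by blast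
    qed
    moreover have "s n \<subseteq> topspace X" for n
      using s[rule_format, of n] openin_subset[of X "s n"] by (simp add: S_def)
    ultimately show ?thesis
      using s absorb by (auto simp: family_covers_def S_def)
  qed
  ultimately show ?thesis unfolding II_mark_G1_iff_answer_sets by blast
qed

text \<open>In each inning some \<open>A n\<close> has the property that every proper open superset of \<open>A n\<close> is a possible
  answer, since otherwise the missing supersets would form a cover without any answer. If \<open>B\<close> escapes
  all \<open>A n\<close>, then the complements of points \<open>x n \<in> B - A n\<close> are answers none of which contains \<open>B\<close>.\<close>

lemma countable_cofinality_if_II_mark_covers:
  assumes "II_mark_G1 (family_covers X \<A>) (family_covers X \<A>)"
  shows "countable_cofinality \<A>"
proof (rule ccontr)
  assume not: "\<not> countable_cofinality \<A>"
  obtain S :: "nat \<Rightarrow> 'a set set" where S: "\<And>n \<U>. \<U> \<in> family_covers X \<A> \<Longrightarrow> S n \<inter> \<U> \<noteq> {}"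
    and win: "\<And>s. (\<And>n. s n \<in> S n) \<Longrightarrow> range s \<in> family_covers X \<A>"
    using assms unfolding II_mark_G1_iff_answer_sets by blast
  define proper where "proper = (\<lambda>A U. openin X U \<and> U \<noteq> topspace X \<and> A \<subseteq> U)"
  have "\<exists>A. A \<in> \<A> \<and> (\<forall>U. proper A U \<longrightarrow> U \<in> S n)" for n
  proof (rule ccontr)
    assume "\<not> ?thesis"
    then have "\<forall>A\<in>\<A>. \<exists>U. proper A U \<and> U \<notin> S n" by blast
    then obtain U where U: "\<And>A. A \<in> \<A> \<Longrightarrow> proper A (U A) \<and> U A \<notin> S n" by metis
    have "U ` \<A> \<in> family_covers X \<A>"
    proof -
      have "topspace X \<subseteq> \<Union>(U ` \<A>)"
      proof
        fix x assume "x \<in> topspace X"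
        then have "{x} \<in> \<A>" by (rule singleton)
        then have "x \<in> U {x}" using U[of "{x}"] by (simp add: proper_def)
        then show "x \<in> \<Union>(U ` \<A>)" using \<open>{x} \<in> \<A>\<close> by blast
      qed
      moreover have "U A \<subseteq> topspace X" if "A \<in> \<A>" for A
        using U[OF that] openin_subset by (auto simp: proper_def)
      moreover have "U A \<noteq> {}" if "A \<in> \<A>" for A
        using U[OF that] nonempty[OF that] by (auto simp: proper_def)
      moreover have "openin X (U A)" "U A \<noteq> topspace X" "A \<subseteq> U A" if "A \<in> \<A>" for A
        using U[OF that] by (simp_all add: proper_def)
      ultimately show ?thesis unfolding family_covers_def by fastforce
    qed
    then show False using S[of "U ` \<A>" n] U by blast
  qed
  then obtain A where A: "\<And>n. A n \<in> \<A>" "\<And>n U. proper (A n) U \<Longrightarrow> U \<in> S n" by metis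
  obtain B where B: "B \<in> \<A>" "\<And>n. \<not> B \<subseteq> A n"
    using not_countable_cofinality_escape[OF not, of A] A(1) by blast
  have "\<forall>n. \<exists>x. x \<in> B \<and> x \<notin> A n" using B(2) by blast
  then obtain x where x: "\<And>n. x n \<in> B" "\<And>n. x n \<notin> A n" by metis
  have xX: "x n \<in> topspace X" for n using x(1) subset_topspace[OF B(1)] by blast
  have "topspace X - {x n} \<in> S n" for n
  proof (rule A(2))
    have "openin X (topspace X - {x n})"
      using closed[OF singleton[OF xX]] by (simp add: closedin_def)
    then show "proper (A n) (topspace X - {x n})"
      using x(2) xX subset_topspace[OF A(1)] by (auto simp: proper_def)
  qed
  then have "range (\<lambda>n. topspace X - {x n}) \<in> family_covers X \<A>" by (rule win)
  then obtain n where "B \<subseteq> topspace X - {x n}" using B(1) by (auto simp: family_covers_def)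
  then show False using x(1) by blast
qed

text \<open>Two answers in inning \<open>n\<close> with a map that is \<open>1/(n+1)\<close>-close to zero on \<open>A n\<close>; as the sequence
  \<open>A n\<close> increases, sufficiently late answers lie in any given neighbourhood of zero.\<close>

lemma II_mark_clustering:
  assumes "countable_cofinality \<A>"
  shows "II_mark_G1 (clustering_sets Y (MC_zero X)) (clustering_sets Y (MC_zero X))"
proof -
  obtain A :: "nat \<Rightarrow> 'a set" where A: "\<And>n. A n \<in> \<A>" "mono A" "\<And>B. B \<in> \<A> \<Longrightarrow> \<exists>n. B \<subseteq> A n"
    using countable_cofinality_increasing[OF assms] by metis
  define S where "S = (\<lambda>n. MC_entourage X (A n) (inverse (real (Suc n))) `` {MC_zero X})"
  have "S n \<inter> C \<noteq> {}" if C: "C \<in> clustering_sets Y (MC_zero X)" for n C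
  proof -
    have "MC_zero X \<in> Y closure_of C" using C by (simp add: clustering_sets_def)
    then have "\<exists>\<Psi>\<in>C. (MC_zero X, \<Psi>) \<in> MC_entourage X (A n) (inverse (real (Suc n)))"
      unfolding closure_iff[OF MC_zero_in_MC] using A(1) by simp
    then show ?thesis by (auto simp: S_def)
  qed
  moreover have "range s \<in> clustering_sets Y (MC_zero X)" if s: "\<forall>n. s n \<in> S n" for s
  proof -
    have "\<exists>\<Psi>\<in>range s. (MC_zero X, \<Psi>) \<in> MC_entourage X B \<epsilon>" if B: "B \<in> \<A>" "\<epsilon> > 0" for B \<epsilon>
    proof -
      obtain k where k: "B \<subseteq> A k" using A(3) B(1) by blast
      obtain m where m: "inverse (real (Suc m)) < \<epsilon>" using reals_Archimedean B(2) by blast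
      let ?n = "max k m"
      have "B \<subseteq> A ?n" using k monoD[OF A(2), of k ?n] by simp
      moreover have "inverse (real (Suc ?n)) \<le> inverse (real (Suc m))" by (simp add: field_simps)
      ultimately have "MC_entourage X (A ?n) (inverse (real (Suc ?n))) \<subseteq> MC_entourage X B \<epsilon>"
        using m by (intro MC_entourage_mono) linarith+
      then show ?thesis using s[rule_format, of ?n] by (auto simp: S_def)
    qed
    then have "MC_zero X \<in> Y closure_of (range s)"
      unfolding closure_iff[OF MC_zero_in_MC] by blast
    moreover have "range s \<subseteq> MC X" using s by (auto simp: S_def MC_entourage_def)
    ultimately show ?thesis by (simp add: clustering_sets_def)
  qed
  ultimately show ?thesis unfolding II_mark_G1_iff_answer_sets by blast
qed

text \<open>The complement of the answers in inning \<open>n\<close> is not dense, so the answers contain a basic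
  neighbourhood, which restricts maps on some \<open>A n\<close> only. If \<open>B\<close> escapes all \<open>A n\<close>, there are answers
  with the value \<open>1\<close> at points of \<open>B\<close>, and these stay away from the zero map on \<open>B\<close>.\<close>

lemma countable_cofinality_if_II_mark_dense:
  assumes "II_mark_G1 (dense_sets Y) (clustering_sets Y (MC_zero X))"
  shows "countable_cofinality \<A>"
proof (rule ccontr)
  assume not: "\<not> countable_cofinality \<A>"
  obtain S :: "nat \<Rightarrow> ('a \<Rightarrow> real set) set" where S: "\<And>n C. C \<in> dense_sets Y \<Longrightarrow> S n \<inter> C \<noteq> {}"
    and win: "\<And>s. (\<And>n. s n \<in> S n) \<Longrightarrow> range s \<in> clustering_sets Y (MC_zero X)"
    using assms unfolding II_mark_G1_iff_answer_sets by blast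
  have "\<exists>\<Phi> A \<epsilon>. \<Phi> \<in> MC X \<and> A \<in> \<A> \<and> 0 < \<epsilon> \<and> MC_entourage X A \<epsilon> `` {\<Phi>} \<subseteq> S n" for n
  proof -
    have "MC X - S n \<notin> dense_sets Y" using S[of "MC X - S n" n] by blast
    then obtain \<Phi> where \<Phi>: "\<Phi> \<in> MC X" "\<Phi> \<notin> Y closure_of (MC X - S n)"
      using closure_of_subset_topspace[of Y "MC X - S n"] by (auto simp: dense_sets_def)
    then obtain A \<epsilon> where A: "A \<in> \<A>" "\<epsilon> > 0" "\<forall>\<Psi>\<in>MC X - S n. (\<Phi>, \<Psi>) \<notin> MC_entourage X A \<epsilon>"
      unfolding closure_iff[OF \<Phi>(1)] by blast
    have "MC_entourage X A \<epsilon> `` {\<Phi>} \<subseteq> S n"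
    proof
      fix \<Psi> assume \<Psi>: "\<Psi> \<in> MC_entourage X A \<epsilon> `` {\<Phi>}"
      then have "\<Psi> \<in> MC X" by (auto simp: MC_entourage_def)
      then show "\<Psi> \<in> S n" using A(3) \<Psi> by blast
    qed
    then show ?thesis using \<Phi>(1) A(1,2) by blast
  qed
  then obtain \<Phi> A \<epsilon> where \<Phi>: "\<And>n. \<Phi> n \<in> MC X" and A: "\<And>n. A n \<in> \<A>" and \<epsilon>: "\<And>n. 0 < (\<epsilon> n :: real)"
    and sub: "\<And>n. MC_entourage X (A n) (\<epsilon> n) `` {\<Phi> n} \<subseteq> S n" by metis
  obtain B where B: "B \<in> \<A>" "\<And>n. \<not> B \<subseteq> A n"
    using not_countable_cofinality_escape[OF not, of A] A by blast
  obtain x s where x: "\<And>n. x n \<in> B" and s1: "\<And>n. s n (x n) = {1}"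
    and ent: "\<And>n. (\<Phi> n, s n) \<in> MC_entourage X (A n) (\<epsilon> n)"
    using prescribe_outside[where A = A and \<Phi> = \<Phi> and \<epsilon> = \<epsilon> and t = "\<lambda>_. 1", OF B(1) A B(2) \<Phi> \<epsilon>]
    by metis
  have "s n \<in> S n" for n using ent sub by blast
  then have "range s \<in> clustering_sets Y (MC_zero X)" by (rule win)
  then have "MC_zero X \<in> Y closure_of (range s)" by (simp add: clustering_sets_def)
  then have "\<exists>\<Psi>\<in>range s. (MC_zero X, \<Psi>) \<in> MC_entourage X B 1"
    unfolding closure_iff[OF MC_zero_in_MC] using B(1) by simp
  then obtain n where "(MC_zero X, s n) \<in> MC_entourage X B 1" by blast
  then have "endpoint_dist (MC_zero X (x n)) (s n (x n)) < 1"
    using x[of n] by (simp add: entourage_iff[OF B(1)])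
  moreover have "x n \<in> topspace X" using x subset_topspace[OF B(1)] by blast
  ultimately show False by (simp add: s1 MC_zero_def endpoint_dist_def)
qed

theorem countable_cofinality_characterizations:
  "countable_cofinality \<A> \<longleftrightarrow> metrizable_space Y"
  "countable_cofinality \<A> \<longleftrightarrow> \<not> discretely_selective Y"
  "countable_cofinality \<A> \<longleftrightarrow> II_mark_G1 (family_covers X \<A>) (family_covers X \<A>)"
  "countable_cofinality \<A> \<longleftrightarrow>
     II_mark_G1 (clustering_sets Y (MC_zero X)) (clustering_sets Y (MC_zero X))"
  "countable_cofinality \<A> \<longleftrightarrow> II_mark_G1 (dense_sets Y) (clustering_sets Y (MC_zero X))"
proof -
  have "\<not> discretely_selective Y" if "metrizable_space Y"
    using metrizable_imp_not_discretely_selective[OF that _ MC_zero_not_isolated] MC_zero_in_MC[of X] by simp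
  then show "countable_cofinality \<A> \<longleftrightarrow> metrizable_space Y"
    "countable_cofinality \<A> \<longleftrightarrow> \<not> discretely_selective Y"
    using metrizable_Y discretely_selective_Y by blast+
  show "countable_cofinality \<A> \<longleftrightarrow> II_mark_G1 (family_covers X \<A>) (family_covers X \<A>)"
    using II_mark_covers countable_cofinality_if_II_mark_covers by blast
  have "dense_sets Y \<subseteq> clustering_sets Y (MC_zero X)"
    using MC_zero_in_MC by (auto simp: dense_sets_def clustering_sets_def)
  then have "II_mark_G1 (dense_sets Y) (clustering_sets Y (MC_zero X))"
    if "II_mark_G1 (clustering_sets Y (MC_zero X)) (clustering_sets Y (MC_zero X))"
    using II_mark_G1_mono that by blast
  then show "countable_cofinality \<A> \<longleftrightarrow>
      II_mark_G1 (clustering_sets Y (MC_zero X)) (clustering_sets Y (MC_zero X))"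
    "countable_cofinality \<A> \<longleftrightarrow> II_mark_G1 (dense_sets Y) (clustering_sets Y (MC_zero X))"
    using II_mark_clustering countable_cofinality_if_II_mark_dense by blast+
qed

end

section \<open>Hemicompactness of the hyperspace of compact sets\<close>

lemma openin_vietoris_subsets:
  assumes "openin X U"
  shows "openin (vietoris X) {K \<in> compact_hyperspace X. K \<subseteq> U}"
  unfolding vietoris_def using assms by (auto intro!: topology_generated_by_Basis)

text \<open>Once finitely many sets of a cover of \<open>X\<close> contain a given member of \<open>\<C>\<close>, they contain all
  nearby members of \<open>\<C>\<close>; compactness of \<open>\<C>\<close> then leaves finitely many such finite subcovers.\<close>

lemma compactin_Union_vietoris:
  assumes "compactin (vietoris X) \<C>"
  shows "compactin X (\<Union>\<C>)"
proof -
  have \<C>: "\<C> \<subseteq> compact_hyperspace X"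
    using compactin_subset_topspace[OF assms] by (simp add: topspace_vietoris)
  show ?thesis
    unfolding compactin_def
  proof (intro conjI allI impI)
    show "\<Union>\<C> \<subseteq> topspace X"
      using \<C> compactin_subset_topspace unfolding compact_hyperspace_def by blast
  next
    fix \<U> assume \<U>: "(\<forall>U\<in>\<U>. openin X U) \<and> \<Union>\<C> \<subseteq> \<Union>\<U>"
    define N where "N = (\<lambda>\<F>. {K \<in> compact_hyperspace X. K \<subseteq> \<Union>\<F>})"
    define \<W> where "\<W> = N ` {\<F>. finite \<F> \<and> \<F> \<subseteq> \<U>}"
    have "openin (vietoris X) (N \<F>)" if "\<F> \<subseteq> \<U>" for \<F>
      unfolding N_def
    proof (rule openin_vietoris_subsets, rule openin_Union)
      show "openin X U" if "U \<in> \<F>" for U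
        using conjunct1[OF \<U>] subsetD[OF \<open>\<F> \<subseteq> \<U>\<close> that] by simp
    qed
    then have "\<forall>W\<in>\<W>. openin (vietoris X) W" by (auto simp: \<W>_def)
    moreover have "\<C> \<subseteq> \<Union>\<W>"
    proof
      fix K assume K: "K \<in> \<C>"
      then have "compactin X K" and KH: "K \<in> compact_hyperspace X"
        using \<C> by (auto simp: compact_hyperspace_def)
      moreover have "K \<subseteq> \<Union>\<U>" using \<U> K by blast
      ultimately obtain \<F> where "finite \<F>" "\<F> \<subseteq> \<U>" "K \<subseteq> \<Union>\<F>"
        using \<U> unfolding compactin_def by meson
      then show "K \<in> \<Union>\<W>" using KH by (auto simp: \<W>_def N_def)
    qed
    ultimately obtain \<G> where \<G>: "finite \<G>" "\<G> \<subseteq> \<W>" "\<C> \<subseteq> \<Union>\<G>"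
      using assms unfolding compactin_def by meson
    obtain \<H> where \<H>: "\<H> \<subseteq> {\<F>. finite \<F> \<and> \<F> \<subseteq> \<U>}" "finite \<H>" "\<G> = N ` \<H>"
      using finite_subset_image[OF \<G>(1) \<G>(2)[unfolded \<W>_def]] by blast
    have "\<Union>\<C> \<subseteq> \<Union>(\<Union>\<H>)"
    proof
      fix x assume "x \<in> \<Union>\<C>"
      then obtain K where "K \<in> \<C>" "x \<in> K" by blast
      then obtain \<F> where "\<F> \<in> \<H>" "K \<in> N \<F>" using \<G>(3) \<H>(3) by blast
      then show "x \<in> \<Union>(\<Union>\<H>)" using \<open>x \<in> K\<close> by (auto simp: N_def)
    qed
    moreover have "finite (\<Union>\<H>)" "\<Union>\<H> \<subseteq> \<U>" using \<H>(1,2) by auto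
    ultimately show "\<exists>\<F>. finite \<F> \<and> \<F> \<subseteq> \<U> \<and> \<Union>\<C> \<subseteq> \<Union>\<F>" by blast
  qed
qed

text \<open>By the Alexander subbase theorem only covers by subbasic sets matter. Let \<open>V\<close> be the union of the
  sets whose hitting sets occur in the cover. If \<open>V\<close> misses part of \<open>K\<close>, then \<open>K - V\<close> is
  a point of the hyperspace that is covered by a containment set \<open>{L. L \<subseteq> U}\<close>; the other compact
  subsets of \<open>K\<close> hit the compact set \<open>K - U \<subseteq> V\<close>, so finitely many hitting sets are enough for them.\<close>

lemma compactin_vietoris_subsets:
  assumes K: "compactin X K"
  shows "compactin (vietoris X) {L \<in> compact_hyperspace X. L \<subseteq> K}"
proof -
  let ?H = "{L \<in> compact_hyperspace X. L \<subseteq> K}"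
  let ?in = "\<lambda>U. {L \<in> compact_hyperspace X. L \<subseteq> U}"
  let ?hit = "\<lambda>U. {L \<in> compact_hyperspace X. L \<inter> U \<noteq> {}}"
  define \<B> where "\<B> = {?in U | U. openin X U} \<union> {?hit U | U. openin X U}"
  define T where "T = topology (arbitrary union_of (finite intersection_of (\<lambda>B. B \<in> \<B>) relative_to ?H))"
  have topT: "topspace T = ?H" by (simp add: T_def)
  have KX: "K \<subseteq> topspace X" using K by (rule compactin_subset_topspace)
  have part: "compactin X (K - U)" if "openin X U" for U
  proof -
    have "K - U = K \<inter> (topspace X - U)" using KX by blast
    moreover have "closedin X (topspace X - U)" using that by blast
    ultimately show ?thesis using compact_Int_closedin[OF K] by simp
  qed
  have "?in (topspace X) \<in> \<B>" unfolding \<B>_def using openin_topspace by blast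
  moreover have "?H \<subseteq> ?in (topspace X)" using KX by blast
  ultimately have \<B>: "?H \<subseteq> \<Union>\<B>" by blast
  have "compact_space T"
  proof (rule Alexander_subbase_alt[OF _ _ T_def[symmetric]])
    show "?H \<subseteq> \<Union>\<B>" by (rule \<B>)
  next
    fix \<C> assume \<C>: "\<C> \<subseteq> \<B>" "?H \<subseteq> \<Union>\<C>"
    define \<V> where "\<V> = {V. openin X V \<and> ?hit V \<in> \<C>}"
    have \<V>: "\<And>V. V \<in> \<V> \<Longrightarrow> openin X V" by (simp add: \<V>_def)
    have hitting: "\<exists>\<C>'. finite \<C>' \<and> \<C>' \<subseteq> \<C> \<and> (\<forall>L\<in>?H. L \<inter> M \<noteq> {} \<longrightarrow> L \<in> \<Union>\<C>')"
      if M: "compactin X M" "M \<subseteq> \<Union>\<V>" for M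
    proof -
      obtain \<F> where \<F>: "finite \<F>" "\<F> \<subseteq> \<V>" "M \<subseteq> \<Union>\<F>"
        using M \<V> unfolding compactin_def by meson
      have "L \<in> \<Union>(?hit ` \<F>)" if "L \<in> ?H" "L \<inter> M \<noteq> {}" for L
        using that \<F>(3) by fastforce
      moreover have "finite (?hit ` \<F>)" "?hit ` \<F> \<subseteq> \<C>" using \<F> by (auto simp: \<V>_def)
      ultimately show ?thesis by blast
    qed
    show "\<exists>\<C>'. finite \<C>' \<and> \<C>' \<subseteq> \<C> \<and> ?H \<subseteq> \<Union>\<C>'"
    proof (cases "K \<subseteq> \<Union>\<V>")
      case True
      obtain \<C>' where \<C>': "finite \<C>'" "\<C>' \<subseteq> \<C>" "\<forall>L\<in>?H. L \<inter> K \<noteq> {} \<longrightarrow> L \<in> \<Union>\<C>'"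
        using hitting[OF K True] by blast
      have "L \<inter> K \<noteq> {}" if "L \<in> ?H" for L using that by (auto simp: compact_hyperspace_def)
      then have "?H \<subseteq> \<Union>\<C>'" using \<C>'(3) by (meson subsetI)
      then show ?thesis using \<C>'(1,2) by (intro exI[of _ \<C>']) simp
    next
      case False
      let ?L = "K - \<Union>\<V>"
      have "compactin X ?L" using \<V> by (intro part openin_Union) blast
      then have L: "?L \<in> ?H" using False by (auto simp: compact_hyperspace_def)
      then obtain C where C: "C \<in> \<C>" "?L \<in> C" using \<C>(2) by blast
      have "\<exists>U. openin X U \<and> C = ?in U"
      proof (rule ccontr)
        assume no: "\<not> ?thesis"
        have "C \<in> \<B>" using C(1) \<C>(1) by (rule subsetD[rotated])
        then obtain V where V: "openin X V" "C = ?hit V" using no unfolding \<B>_def by blast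
        then have "V \<in> \<V>" using C(1) by (simp add: \<V>_def)
        then show False using C(2) V(2) by blast
      qed
      then obtain U where U: "openin X U" "C = ?in U" by blast
      have "K - U \<subseteq> \<Union>\<V>" using C(2) U(2) by blast
      then obtain \<C>' where \<C>': "finite \<C>'" "\<C>' \<subseteq> \<C>" "\<forall>L\<in>?H. L \<inter> (K - U) \<noteq> {} \<longrightarrow> L \<in> \<Union>\<C>'"
        using hitting[OF part[OF U(1)]] by blast
      have "L \<in> \<Union>(insert C \<C>')" if "L \<in> ?H" for L
      proof (cases "L \<subseteq> U")
        case True
        then show ?thesis using that U(2) by blast
      next
        case False
        then have "L \<inter> (K - U) \<noteq> {}" using that by blast
        then show ?thesis using \<C>'(3) that by blast
      qed
      then show ?thesis using \<C>'(1,2) C(1) by (intro exI[of _ "insert C \<C>'"]) blast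
    qed
  qed
  moreover have "continuous_map T (vietoris X) (\<lambda>L. L)"
    unfolding vietoris_def
  proof (rule continuous_on_generated_topo)
    fix B assume "B \<in> {?in U | U. openin X U} \<union> {?hit U | U. openin X U}"
    then have "B \<in> \<B>" by (simp add: \<B>_def)
    then have "openin T (?H \<inter> B)"
      unfolding T_def openin_subbase
      by (intro arbitrary_union_of_inc relative_to_inc finite_intersection_of_inc)
    then show "openin T ((\<lambda>L. L) -` B \<inter> topspace T)" by (simp add: topT Int_commute vimage_def)
  next
    show "(\<lambda>L. L) ` topspace T \<subseteq> \<Union>({?in U | U. openin X U} \<union> {?hit U | U. openin X U})"
      using \<B> by (simp add: topT \<B>_def)
  qed
  ultimately show ?thesis
    using image_compactin[of T "topspace T" "vietoris X" "\<lambda>L. L"] topT by (simp add: compact_space_def)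
qed

lemma hemicompact_iff_hyperspace_hemicompact:
  "hemicompact_space X \<longleftrightarrow> hemicompact_space (vietoris X)"
proof
  assume "hemicompact_space X"
  then obtain K :: "nat \<Rightarrow> 'a set" where K: "\<And>n. compactin X (K n)" "\<And>C. compactin X C \<Longrightarrow> \<exists>n. C \<subseteq> K n"
    unfolding hemicompact_space_def by metis
  define H where "H = (\<lambda>n. {L \<in> compact_hyperspace X. L \<subseteq> K n})"
  have "compactin (vietoris X) (H n)" for n
    unfolding H_def by (rule compactin_vietoris_subsets[OF K(1)])
  moreover have "\<exists>n. \<C> \<subseteq> H n" if \<C>: "compactin (vietoris X) \<C>" for \<C>
  proof -
    obtain n where "\<Union>\<C> \<subseteq> K n" using K(2)[OF compactin_Union_vietoris[OF \<C>]] ..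
    moreover have "\<C> \<subseteq> compact_hyperspace X"
      using compactin_subset_topspace[OF \<C>] by (simp add: topspace_vietoris)
    ultimately have "\<C> \<subseteq> H n" by (auto simp: H_def)
    then show ?thesis by blast
  qed
  ultimately show "hemicompact_space (vietoris X)" unfolding hemicompact_space_def by blast
next
  assume "hemicompact_space (vietoris X)"
  then obtain H :: "nat \<Rightarrow> 'a set set" where H: "\<And>n. compactin (vietoris X) (H n)"
    "\<And>\<C>. compactin (vietoris X) \<C> \<Longrightarrow> \<exists>n. \<C> \<subseteq> H n"
    unfolding hemicompact_space_def by metis
  have "\<exists>n. C \<subseteq> \<Union>(H n)" if C: "compactin X C" for C
  proof (cases "C = {}")
    case False
    then have "compactin (vietoris X) {C}"
      using C by (simp add: compactin_sing topspace_vietoris compact_hyperspace_def)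
    then obtain n where "{C} \<subseteq> H n" using H(2) by blast
    then show ?thesis by blast
  qed simp
  then show "hemicompact_space X"
    unfolding hemicompact_space_def
    using compactin_Union_vietoris[OF H(1)] by (intro exI[of _ "\<lambda>n. \<Union>(H n)"]) blast
qed

section \<open>Finite sets and compact sets\<close>

lemma countable_cofinality_finite_iff:
  assumes "S \<noteq> {}"
  shows "countable_cofinality {F. F \<noteq> {} \<and> finite F \<and> F \<subseteq> S} \<longleftrightarrow> countable S"
proof
  assume "countable_cofinality {F. F \<noteq> {} \<and> finite F \<and> F \<subseteq> S}"
  then obtain A :: "nat \<Rightarrow> 'a set" where A: "\<And>n. A n \<noteq> {} \<and> finite (A n) \<and> A n \<subseteq> S"
    "\<And>F. F \<noteq> {} \<Longrightarrow> finite F \<Longrightarrow> F \<subseteq> S \<Longrightarrow> \<exists>n. F \<subseteq> A n"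
    unfolding countable_cofinality_def mem_Collect_eq Ball_def by metis
  have "S \<subseteq> (\<Union>n. A n)"
  proof
    fix x assume "x \<in> S"
    then show "x \<in> (\<Union>n. A n)" using A(2)[of "{x}"] by auto
  qed
  moreover have "countable (\<Union>n. A n)" using A(1) by (intro countable_UN) (auto intro: countable_finite)
  ultimately show "countable S" by (rule countable_subset)
next
  assume S: "countable S"
  define A where "A = (\<lambda>n::nat. from_nat_into S ` {..n})"
  have "A n \<noteq> {} \<and> finite (A n) \<and> A n \<subseteq> S" for n
    using from_nat_into[OF assms] by (auto simp: A_def)
  moreover have "\<exists>n. F \<subseteq> A n" if F: "finite F" "F \<subseteq> S" for F
  proof -
    have "F \<subseteq> range (from_nat_into S)" using range_from_nat_into[OF assms S] F(2) by simp
    then obtain I where I: "finite I" "F = from_nat_into S ` I"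
      using finite_subset_image[OF F(1)] by blast
    then obtain n where "\<forall>i\<in>I. i \<le> n" using finite_nat_set_iff_bounded_le by blast
    then have "F \<subseteq> A n" using I(2) by (auto simp: A_def)
    then show ?thesis by blast
  qed
  ultimately show "countable_cofinality {F. F \<noteq> {} \<and> finite F \<and> F \<subseteq> S}"
    unfolding countable_cofinality_def by (intro exI[of _ A]) auto
qed

lemma countable_cofinality_compact_iff:
  assumes "topspace X \<noteq> {}"
  shows "countable_cofinality {K. K \<noteq> {} \<and> compactin X K} \<longleftrightarrow> hemicompact_space X"
proof
  assume "countable_cofinality {K. K \<noteq> {} \<and> compactin X K}"
  then obtain A :: "nat \<Rightarrow> 'a set" where A: "\<And>n. compactin X (A n)"
    "\<And>K. K \<noteq> {} \<Longrightarrow> compactin X K \<Longrightarrow> \<exists>n. K \<subseteq> A n"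
    unfolding countable_cofinality_def mem_Collect_eq Ball_def by metis
  have "\<exists>n. K \<subseteq> A n" if "compactin X K" for K
    using A(2)[OF _ that] by (cases "K = {}") auto
  then show "hemicompact_space X" unfolding hemicompact_space_def using A(1) by blast
next
  assume "hemicompact_space X"
  then obtain K :: "nat \<Rightarrow> 'a set" where K: "\<And>n. compactin X (K n)" "\<And>C. compactin X C \<Longrightarrow> \<exists>n. C \<subseteq> K n"
    unfolding hemicompact_space_def by metis
  obtain x where x: "x \<in> topspace X" using assms by blast
  have "compactin X (insert x (K n))" for n
    using compactin_Un[OF finite_imp_compactin[of "{x}" X] K(1)[of n]] x by simp
  moreover have "\<exists>n. C \<subseteq> insert x (K n)" if "compactin X C" for C
    using K(2)[OF that] by blast
  ultimately show "countable_cofinality {K. K \<noteq> {} \<and> compactin X K}"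
    unfolding countable_cofinality_def by (intro exI[of _ "\<lambda>n. insert x (K n)"]) simp
qed

text \<open>The empty set, which the families of non-empty sets leave out, is a subset of every member of a cover,
  and a cover of a non-empty space has members.\<close>

lemma omega_covers_eq:
  assumes "topspace X \<noteq> {}"
  shows "omega_covers X = family_covers X {F. F \<noteq> {} \<and> finite F \<and> F \<subseteq> topspace X}"
proof -
  have eq: "(\<forall>F. finite F \<and> F \<subseteq> topspace X \<longrightarrow> (\<exists>U\<in>\<U>. F \<subseteq> U)) \<longleftrightarrow>
        (\<forall>F\<in>{F. F \<noteq> {} \<and> finite F \<and> F \<subseteq> topspace X}. \<exists>U\<in>\<U>. F \<subseteq> U)"
    if "\<Union>\<U> = topspace X" for \<U>
  proof -
    have "\<U> \<noteq> {}" using that assms by (metis Union_empty)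
    then have "\<exists>U\<in>\<U>. {} \<subseteq> U" by blast
    then show ?thesis by auto
  qed
  show ?thesis
    unfolding omega_covers_def family_covers_def by (intro Collect_cong conj_cong refl eq)
qed

lemma k_covers_eq:
  assumes "topspace X \<noteq> {}"
  shows "k_covers X = family_covers X {K. K \<noteq> {} \<and> compactin X K}"
proof -
  have eq: "(\<forall>K. compactin X K \<longrightarrow> (\<exists>U\<in>\<U>. K \<subseteq> U)) \<longleftrightarrow>
        (\<forall>K\<in>{K. K \<noteq> {} \<and> compactin X K}. \<exists>U\<in>\<U>. K \<subseteq> U)"
    if "\<Union>\<U> = topspace X" for \<U>
  proof -
    have "\<U> \<noteq> {}" using that assms by (metis Union_empty)
    then have "\<exists>U\<in>\<U>. {} \<subseteq> U" by blast
    then show ?thesis by auto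
  qed
  show ?thesis
    unfolding k_covers_def family_covers_def by (intro Collect_cong conj_cong refl eq)
qed

theorem corollary41:
  fixes X :: "'a topology"
  assumes "regular_space X" and "Hausdorff_space X"
  shows
    "(infinite (topspace X) \<longrightarrow>
        (countable (topspace X) \<longleftrightarrow> metrizable_space (MC_p X)) \<and>
        (countable (topspace X) \<longleftrightarrow> \<not> discretely_selective (MC_p X)) \<and>
        (countable (topspace X) \<longleftrightarrow> II_mark_G1 (omega_covers X) (omega_covers X)) \<and>
        (countable (topspace X) \<longleftrightarrow>
           II_mark_G1 (clustering_sets (MC_p X) (MC_zero X)) (clustering_sets (MC_p X) (MC_zero X))) \<and>
        (countable (topspace X) \<longleftrightarrow>
           II_mark_G1 (dense_sets (MC_p X)) (clustering_sets (MC_p X) (MC_zero X))))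
     \<and>
     (\<not> compact_space X \<longrightarrow>
        (hemicompact_space X \<longleftrightarrow> hemicompact_space (vietoris X)) \<and>
        (hemicompact_space X \<longleftrightarrow> metrizable_space (MC_k X)) \<and>
        (hemicompact_space X \<longleftrightarrow> \<not> discretely_selective (MC_k X)) \<and>
        (hemicompact_space X \<longleftrightarrow> II_mark_G1 (k_covers X) (k_covers X)) \<and>
        (hemicompact_space X \<longleftrightarrow>
           II_mark_G1 (clustering_sets (MC_k X) (MC_zero X)) (clustering_sets (MC_k X) (MC_zero X))) \<and>
        (hemicompact_space X \<longleftrightarrow>
           II_mark_G1 (dense_sets (MC_k X)) (clustering_sets (MC_k X) (MC_zero X))))"
proof (rule conjI; rule impI)
  assume "infinite (topspace X)"
  then have ne: "topspace X \<noteq> {}" by auto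
  interpret fin: compact_family X "{F. F \<noteq> {} \<and> finite F \<and> F \<subseteq> topspace X}"
    using assms ne by unfold_locales (auto intro: finite_imp_compactin)
  note * = fin.countable_cofinality_characterizations[unfolded countable_cofinality_finite_iff[OF ne]
      omega_covers_eq[OF ne, symmetric] MC_p_def[symmetric]]
  show "(countable (topspace X) \<longleftrightarrow> metrizable_space (MC_p X)) \<and>
        (countable (topspace X) \<longleftrightarrow> \<not> discretely_selective (MC_p X)) \<and>
        (countable (topspace X) \<longleftrightarrow> II_mark_G1 (omega_covers X) (omega_covers X)) \<and>
        (countable (topspace X) \<longleftrightarrow>
           II_mark_G1 (clustering_sets (MC_p X) (MC_zero X)) (clustering_sets (MC_p X) (MC_zero X))) \<and>
        (countable (topspace X) \<longleftrightarrow>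
           II_mark_G1 (dense_sets (MC_p X)) (clustering_sets (MC_p X) (MC_zero X)))"
    by (intro conjI) (rule *)+
next
  assume "\<not> compact_space X"
  then have ne: "topspace X \<noteq> {}" by (auto simp: compact_space_def)
  interpret cpt: compact_family X "{K. K \<noteq> {} \<and> compactin X K}"
    using assms ne by unfold_locales (auto intro: compactin_Un)
  note * = cpt.countable_cofinality_characterizations[unfolded countable_cofinality_compact_iff[OF ne]
      k_covers_eq[OF ne, symmetric] MC_k_def[symmetric]]
  show "(hemicompact_space X \<longleftrightarrow> hemicompact_space (vietoris X)) \<and>
        (hemicompact_space X \<longleftrightarrow> metrizable_space (MC_k X)) \<and>
        (hemicompact_space X \<longleftrightarrow> \<not> discretely_selective (MC_k X)) \<and>
        (hemicompact_space X \<longleftrightarrow> II_mark_G1 (k_covers X) (k_covers X)) \<and>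
        (hemicompact_space X \<longleftrightarrow>
           II_mark_G1 (clustering_sets (MC_k X) (MC_zero X)) (clustering_sets (MC_k X) (MC_zero X))) \<and>
        (hemicompact_space X \<longleftrightarrow>
           II_mark_G1 (dense_sets (MC_k X)) (clustering_sets (MC_k X) (MC_zero X)))"
    by (intro conjI hemicompact_iff_hyperspace_hemicompact) (rule *)+
qed

end
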